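(* Let $G=(V,E)$ be a finite connected multi-graph, let $\mathcal{H}$ be a Schrödinger operator on $G$, and let $\mathcal{H}^{\mathrm{ab}}$ be its pull-back to the maximal abelian cover $G^{\mathrm{ab}}$, acting on $\ell^2(V_{G^{\mathrm{ab}}})$. For any $\lambda\in\mathbb{R}$, $\lambda$ is an eigenvalue of $\mathcal{H}^{\mathrm{ab}}$ if and only if for every degree-$2$ subgraph $\gamma$ of $G$ (including the empty subgraph), $\lambda$ is a root of the generalized matching polynomial $m^{\mathcal{H}}_{G\setminus\gamma}$.
   Context: Multi-graphs may have self-loops and multiple edges; a self-loop contributes $2$ to the degree of its vertex. For a multi-graph $G=(V,E)$, $\vec{E}$ is the set of directed edges: every $e\in E$ (including each self-loop) appears in $\vec E$ with both orientations. For $e\in\vec E$, $o(e)$ and $t(e)$ are its origin and terminus and $e^{-1}$ is the same edge with the opposite orientation. A Schrödinger operator on a finite multi-graph $G$ is an operator $\mathcal{H}:\ell^2(V)\to\ell^2(V)$ with matrix entries $\mathcal{H}_{uv}=\sum_{e\in\vec E:\,o(e)=u,\,t(e)=v}w_e+\delta_{uv}\mathcal{V}_v$, where $w_e\in\mathbb{C}$, $w_e=\overline{w_{e^{-1}}}\neq 0$ and $\mathcal{V}_v\in\mathbb{R}$. The maximal abelian cover of $G$ is $G^{\mathrm{ab}}=\tilde G/[\pi_1(G),\pi_1(G)]$, where $\tilde G$ is the universal cover of $G$ and $\pi_1(G)$ acts on $\tilde G$ by deck transformations; equivalently it is the maximal connected Galois cover of $G$ with abelian deck group. $\mathcal{H}^{\mathrm{ab}}$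 is the Schrödinger operator on $\ell^2(V_{G^{\mathrm{ab}}})$ whose edge weights and vertex potentials are the pull-backs of those of $\mathcal{H}$ along the covering map. An eigenvalue of $\mathcal{H}^{\mathrm{ab}}$ is a $\lambda$ for which there is a nonzero $f\in\ell^2(V_{G^{\mathrm{ab}}})$ with $\mathcal{H}^{\mathrm{ab}}f=\lambda f$. A degree-$2$ subgraph of $G$ is a subgraph (not necessarily induced or spanning) in which every vertex has degree $2$, i.e. a vertex-disjoint union of cycles, where a self-loop is a cycle of length $1$ and two distinct parallel edges form a cycle of length $2$; the empty subgraph is included. $G\setminus\gamma$ is the induced subgraph of $G$ on $V\setminus V_\gamma$. A matching of $G$ is a degree-$1$ subgraph (a set of pairwise disjoint non-loop edges with their endpoints); the empty graph is a matching. For a matching $M$, $V_M$ and $\vec E_M$ denote its vertex set and its set of directed edges (both orientations of each edge). $\mathcal{M}(G)$ is the set of matchings of $G$. The generalized matching polynomial is $$m_G^{\mathcal{H}}(x)=\sum_{M\in\mathcal{M}(G)}(-1)^{|V_M|/2}\prod_{e\in\vec E_M}w_e\cdot\prod_{u\in V\setminus V_M}(x-\mathcal{V}_u),$$ and for a subgraph $G_0$ of $G$, $m^{\mathcal{H}}_{G_0}$ is defined in the same way using the restriction of the weights and potentials to $G_0$. The generalized matching polynomial of the empty graph is the constant $1$. *)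

theory Defs
  imports
    "HOL-Analysis.Infinite_Sum"
    "HOL-Algebra.Generated_Groups"
    "HOL-Algebra.Group_Action"
    "HOL-Computational_Algebra.Polynomial"
    "Graph_Theory.Graph_Theory"
begin

text \<open>
  A multi-graph with self-loops and multiple edges is given by its directed edges: a digraph
  \<open>G\<close> with an edge reversal \<open>arev\<close> satisfying \<open>bidirected_digraph G arev\<close>. Since \<open>arev\<close> has no
  fixed points on the arcs, an undirected edge (self-loops included) is a pair
  \<open>{e, arev e}\<close> of two distinct arcs. In particular \<open>out_degree\<close> is the degree of the
  multi-graph in which a self-loop counts twice. (By the convention of that locale \<open>arev\<close> is the
  identity outside \<open>arcs G\<close>.)
\<close>


section \<open>Schroedinger operators\<close>

definition schroedinger_weight ::
    "('v, 'e) pre_digraph \<Rightarrow> ('e \<Rightarrow> 'e) \<Rightarrow> ('e \<Rightarrow> complex) \<Rightarrow> bool" where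
  "schroedinger_weight G arev w \<longleftrightarrow> (\<forall>e \<in> arcs G. w e = cnj (w (arev e)) \<and> w e \<noteq> 0)"

definition schroedinger_entry ::
    "('v, 'e) pre_digraph \<Rightarrow> ('e \<Rightarrow> complex) \<Rightarrow> ('v \<Rightarrow> real) \<Rightarrow> 'v \<Rightarrow> 'v \<Rightarrow> complex" where
  "schroedinger_entry G w pot u v =
     (\<Sum>e | e \<in> arcs G \<and> tail G e = u \<and> head G e = v. w e)
     + (if u = v then complex_of_real (pot v) else 0)"

text \<open>
  On a locally finite graph only finitely many terms of the following sum are nonzero.
\<close>

definition schroedinger ::
    "('v, 'e) pre_digraph \<Rightarrow> ('e \<Rightarrow> complex) \<Rightarrow> ('v \<Rightarrow> real) \<Rightarrow> ('v \<Rightarrow> complex) \<Rightarrow> 'v \<Rightarrow> complex" where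
  "schroedinger G w pot f u = infsum (\<lambda>v. schroedinger_entry G w pot u v * f v) (verts G)"

definition ell2_on :: "'v set \<Rightarrow> ('v \<Rightarrow> complex) set" where
  "ell2_on A = {f. (\<lambda>v. (cmod (f v))\<^sup>2) summable_on A}"

definition schroedinger_eigenvalue ::
    "('v, 'e) pre_digraph \<Rightarrow> ('e \<Rightarrow> complex) \<Rightarrow> ('v \<Rightarrow> real) \<Rightarrow> complex \<Rightarrow> bool" where
  "schroedinger_eigenvalue G w pot z \<longleftrightarrow>
     (\<exists>f \<in> ell2_on (verts G). (\<exists>v \<in> verts G. f v \<noteq> 0) \<and>
        (\<forall>u \<in> verts G. schroedinger G w pot f u = z * f u))"


section \<open>Universal cover and fundamental group\<close>

text \<open>
  Homotopy classes of walks are represented by their unique reduced (non-backtracking)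
  representatives. Appending an arc to a reduced walk cancels it against the last arc if that is
  its reverse.
\<close>

definition reduced :: "('e \<Rightarrow> 'e) \<Rightarrow> 'e list \<Rightarrow> bool" where
  "reduced arev p \<longleftrightarrow> successively (\<lambda>a b. b \<noteq> arev a) p"

definition append_arc :: "('e \<Rightarrow> 'e) \<Rightarrow> 'e list \<Rightarrow> 'e \<Rightarrow> 'e list" where
  "append_arc arev p e = (if p \<noteq> [] \<and> last p = arev e then butlast p else p @ [e])"

text \<open>The reduced form of the concatenation of \<open>p\<close> and \<open>q\<close>, for reduced \<open>p\<close>.\<close>

definition walk_mult :: "('e \<Rightarrow> 'e) \<Rightarrow> 'e list \<Rightarrow> 'e list \<Rightarrow> 'e list" where
  "walk_mult arev p q = foldl (append_arc arev) p q"

definition walk_end :: "('v, 'e) pre_digraph \<Rightarrow> 'v \<Rightarrow> 'e list \<Rightarrow> 'v" where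
  "walk_end G r p = last (pre_digraph.awalk_verts G r p)"

text \<open>
  The arc \<open>(p, e)\<close> of the universal cover is the lift of \<open>e\<close> starting at the vertex \<open>p\<close>.
  The covering map is \<open>walk_end G r\<close> on vertices and \<open>snd\<close> on arcs.
\<close>

definition universal_cover ::
    "('v, 'e) pre_digraph \<Rightarrow> ('e \<Rightarrow> 'e) \<Rightarrow> 'v \<Rightarrow> ('e list, 'e list \<times> 'e) pre_digraph" where
  "universal_cover G arev r =
     \<lparr> verts = {p. pre_digraph.awalk G r p (walk_end G r p) \<and> reduced arev p},
       arcs = {(p, e). pre_digraph.awalk G r p (walk_end G r p) \<and> reduced arev p
                 \<and> e \<in> arcs G \<and> tail G e = walk_end G r p},
       tail = fst,
       head = (\<lambda>(p, e). append_arc arev p e) \<rparr>"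

definition pi1 :: "('v, 'e) pre_digraph \<Rightarrow> ('e \<Rightarrow> 'e) \<Rightarrow> 'v \<Rightarrow> 'e list monoid" where
  "pi1 G arev r =
     \<lparr> carrier = {g. pre_digraph.awalk G r g r \<and> reduced arev g},
       monoid.mult = walk_mult arev,
       one = [] \<rparr>"

definition deck_vert :: "('e \<Rightarrow> 'e) \<Rightarrow> 'e list \<Rightarrow> 'e list \<Rightarrow> 'e list" where
  "deck_vert arev g p = walk_mult arev g p"

definition deck_arc :: "('e \<Rightarrow> 'e) \<Rightarrow> 'e list \<Rightarrow> 'e list \<times> 'e \<Rightarrow> 'e list \<times> 'e" where
  "deck_arc arev g = map_prod (walk_mult arev g) id"


section \<open>The maximal abelian cover\<close>

text \<open>
  Quotient of \<open>T\<close> by a group acting on \<open>T\<close> by graph automorphisms (\<open>\<phi>\<close> on vertices, \<open>\<psi>\<close> on arcs).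
  By equivariance the image of an orbit of arcs under \<open>tail T\<close> or \<open>head T\<close> is an orbit of vertices.
\<close>

definition quotient_graph ::
    "('a, 'b) pre_digraph \<Rightarrow> 'g monoid \<Rightarrow> ('g \<Rightarrow> 'a \<Rightarrow> 'a) \<Rightarrow> ('g \<Rightarrow> 'b \<Rightarrow> 'b)
       \<Rightarrow> ('a set, 'b set) pre_digraph" where
  "quotient_graph T N \<phi> \<psi> =
     \<lparr> verts = orbits N (verts T) \<phi>,
       arcs = orbits N (arcs T) \<psi>,
       tail = image (tail T),
       head = image (head T) \<rparr>"

definition commutator_pi1 :: "('v, 'e) pre_digraph \<Rightarrow> ('e \<Rightarrow> 'e) \<Rightarrow> 'v \<Rightarrow> 'e list monoid" where
  "commutator_pi1 G arev r =
     (pi1 G arev r)\<lparr>carrier := derived (pi1 G arev r) (carrier (pi1 G arev r))\<rparr>"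

definition abelian_cover ::
    "('v, 'e) pre_digraph \<Rightarrow> ('e \<Rightarrow> 'e) \<Rightarrow> 'v \<Rightarrow> ('e list set, ('e list \<times> 'e) set) pre_digraph" where
  "abelian_cover G arev r =
     quotient_graph (universal_cover G arev r) (commutator_pi1 G arev r)
       (deck_vert arev) (deck_arc arev)"

text \<open>
  The covering map from the maximal abelian cover to \<open>G\<close>; the covering map of the universal cover
  is constant on orbits.
\<close>

definition ab_vert :: "('v, 'e) pre_digraph \<Rightarrow> 'v \<Rightarrow> 'e list set \<Rightarrow> 'v" where
  "ab_vert G r X = the_elem (walk_end G r ` X)"

definition ab_arc :: "('e list \<times> 'e) set \<Rightarrow> 'e" where
  "ab_arc A = the_elem (snd ` A)"


section \<open>Subgraphs and the generalized matching polynomial\<close>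

text \<open>
  Sub-multi-graphs in which every vertex has degree \<open>d\<close>; closure under \<open>arev\<close> makes the arcs
  those of a set of undirected edges.
\<close>

definition degree_subgraph ::
    "nat \<Rightarrow> ('v, 'e) pre_digraph \<Rightarrow> ('e \<Rightarrow> 'e) \<Rightarrow> ('v, 'e) pre_digraph \<Rightarrow> bool" where
  "degree_subgraph d G arev H \<longleftrightarrow>
     subgraph H G \<and> (\<forall>e \<in> arcs H. arev e \<in> arcs H) \<and> (\<forall>v \<in> verts H. out_degree H v = d)"

definition matchings ::
    "('v, 'e) pre_digraph \<Rightarrow> ('e \<Rightarrow> 'e) \<Rightarrow> ('v, 'e) pre_digraph set" where
  "matchings G arev = {M. degree_subgraph 1 G arev M}"

definition matching_poly ::
    "('v, 'e) pre_digraph \<Rightarrow> ('e \<Rightarrow> 'e) \<Rightarrow> ('e \<Rightarrow> complex) \<Rightarrow> ('v \<Rightarrow> real) \<Rightarrow> complex poly" where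
  "matching_poly G arev w pot =
     (\<Sum>M \<in> matchings G arev.
        smult ((-1) ^ (card (verts M) div 2) * (\<Prod>e \<in> arcs M. w e))
          (\<Prod>u \<in> verts G - verts M. [:- complex_of_real (pot u), 1:]))"

definition delete_subgraph ::
    "('v, 'e) pre_digraph \<Rightarrow> ('v, 'e) pre_digraph \<Rightarrow> ('v, 'e) pre_digraph" where
  "delete_subgraph G H = induce_subgraph G (verts G - verts H)"

end

theory Submission
  imports Defs
    "HOL-Analysis.Convex"
    "HOL-Library.Poly_Mapping"
    "HOL-Real_Asymp.Real_Asymp"
    "Jordan_Normal_Form.Determinant"
begin

text \<open>
  Give every arc \<open>e\<close> a formal chain \<open>[e]\<close> with \<open>[arev e] = - [e]\<close>, and let the vertices of a periodic
  graph be the pairs of a vertex of \<open>G\<close> and a chain, an arc \<open>e\<close> leading from \<open>(u, k)\<close> to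
  \<open>(head e, k - [e])\<close>. A closed walk lies in the commutator subgroup of the fundamental group exactly
  if its chain is zero (\<open>derived_zero_chain\<close>, \<open>zero_chain_derived\<close>), so a vertex of the maximal abelian
  cover is determined by its projection and the chain of a walk leading to it. The cover is therefore
  a connected component of the periodic graph; by translation every eigenfunction of the periodic
  graph that does not vanish identically gives one on this component.

  On the periodic graph a square summable eigenfunction forces a finitely supported one
  (\<open>finitely_supported_eigenfunction\<close>). The restrictions of the square summable eigenfunctions to a
  large box span a space whose dimension is at least a fixed fraction of the size of the box, because
  every point of the box carries a translate of the given eigenfunction. The boundary of the box has
  fewer points than that, so some nonzero eigenfunction vanishes near the boundary and may be cut off.

  A finitely supported eigenfunction is a vector over the group ring of the chains that is killed by
  the matrix \<open>\<lambda> - H\<close> in which each arc weight is multiplied by the monomial of its chain. The group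
  ring is an integral domain, so such a vector exists exactly if the determinant of this matrix
  vanishes (\<open>finite_eigenfunction_iff_det\<close>).

  The terms of the Leibniz formula correspond to the sets of arcs that enter and leave each vertex at
  most once and enter the same vertices as they leave. In such a set the arcs that occur together with
  their reverses form a matching, whose monomials cancel; the other arcs are an orientation of a
  degree-2 subgraph, which can be read off from the total chain. Hence the coefficient of the monomial
  of an oriented degree-2 subgraph \<open>\<gamma>\<close> is the product of the weights along \<open>\<gamma>\<close>, up to sign, times
  \<open>m_{G - \<gamma>}(\<lambda>)\<close> (\<open>det_twisted\<close>). As the weights are nonzero and every degree-2 subgraph has an
  orientation (\<open>degree_2_has_orientation\<close>), the determinant vanishes exactly if all the
  \<open>m_{G - \<gamma>}(\<lambda>)\<close> do.
\<close>

section \<open>Finite-dimensional spaces of functions\<close>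

definition function_space :: "('x \<Rightarrow> complex) set \<Rightarrow> bool" where
  "function_space W \<longleftrightarrow> (\<lambda>x. 0) \<in> W \<and>
     (\<forall>f\<in>W. \<forall>g\<in>W. \<forall>c. (\<lambda>x. f x + c * g x) \<in> W)"

lemma function_spaceD:
  assumes "function_space W"
  shows "(\<lambda>x. 0) \<in> W"
    and "f \<in> W \<Longrightarrow> g \<in> W \<Longrightarrow> (\<lambda>x. f x + c * g x) \<in> W"
    and "f \<in> W \<Longrightarrow> (\<lambda>x. c * f x) \<in> W"
proof -
  show z: "(\<lambda>x. 0) \<in> W" using assms by (simp add: function_space_def)
  show a: "(\<lambda>x. f x + c * g x) \<in> W" if "f \<in> W" "g \<in> W" for f g c
    using assms that by (simp add: function_space_def)
  show "(\<lambda>x. c * f x) \<in> W" if "f \<in> W" using a[OF z that, of c] by simp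
qed

text \<open>
  Gram--Schmidt, by induction on \<open>B\<close>: the functions in \<open>W\<close> that vanish at a point of \<open>B\<close> form a subspace
  of codimension at most one, which is determined by its values at the other points of \<open>B\<close>.
\<close>

lemma orthonormal_basis_from_determining_set:
  fixes W :: "('x \<Rightarrow> complex) set"
  assumes "finite F" "finite B" "B \<subseteq> F"
    and W: "function_space W"
    and det: "\<forall>f\<in>W. (\<forall>x\<in>B. f x = 0) \<longrightarrow> (\<forall>x\<in>F. f x = 0)"
  shows "\<exists>(m::nat) u. m \<le> card B \<and> (\<forall>i<m. u i \<in> W) \<and>
    (\<forall>i<m. \<forall>j<m. (\<Sum>x\<in>F. u i x * cnj (u j x)) = (if i = j then 1 else 0)) \<and>
    (\<forall>f\<in>W. \<exists>c. \<forall>x\<in>F. f x = (\<Sum>i<m. c i * u i x))"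
  using assms(2,3) W det
proof (induction B arbitrary: W rule: finite_induct)
  case empty
  show ?case
    by (rule exI[of _ "0::nat"]) (use empty.prems(3) in simp)
next
  case (insert b B)
  define W' where "W' = {f\<in>W. f b = 0}"
  have "\<exists>(m::nat) u. m \<le> card B \<and> (\<forall>i<m. u i \<in> W') \<and>
    (\<forall>i<m. \<forall>j<m. (\<Sum>x\<in>F. u i x * cnj (u j x)) = (if i = j then 1 else 0)) \<and>
    (\<forall>f\<in>W'. \<exists>c. \<forall>x\<in>F. f x = (\<Sum>i<m. c i * u i x))"
  proof (rule insert.IH)
    show "function_space W'"
      using insert.prems(2) by (simp add: function_space_def W'_def)
    show "\<forall>f\<in>W'. (\<forall>x\<in>B. f x = 0) \<longrightarrow> (\<forall>x\<in>F. f x = 0)"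
    proof (intro ballI impI)
      fix f x assume "f \<in> W'" "\<forall>x\<in>B. f x = 0" "x \<in> F"
      then have "f \<in> W" "\<forall>x\<in>insert b B. f x = 0" by (simp_all add: W'_def)
      with insert.prems(3) \<open>x \<in> F\<close> show "f x = 0" by blast
    qed
  qed (use insert.prems(1) in auto)
  then obtain m :: nat and u where m: "m \<le> card B" and uW': "\<And>i. i < m \<Longrightarrow> u i \<in> W'"
    and orth: "\<And>i j. i < m \<Longrightarrow> j < m \<Longrightarrow> (\<Sum>x\<in>F. u i x * cnj (u j x)) = (if i = j then 1 else 0)"
    and span: "\<And>f. f \<in> W' \<Longrightarrow> \<exists>c. \<forall>x\<in>F. f x = (\<Sum>i<m. c i * u i x)" by blast
  show ?case
  proof (cases "W' = W")
    case True
    then show ?thesis using m uW' orth span insert.hyps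
      by (intro exI[of _ m] exI[of _ u]) auto
  next
    case False
    then obtain v where v: "v \<in> W" "v b \<noteq> 0" by (auto simp: W'_def)
    define a where "a i = - (\<Sum>y\<in>F. v y * cnj (u i y))" for i
    have lin: "(\<lambda>x. \<Sum>i<k. c i * u i x) \<in> W" if "k \<le> m" for k and c :: "nat \<Rightarrow> complex"
      using that
    proof (induction k)
      case 0 show ?case using function_spaceD(1)[OF insert.prems(2)] by simp
    next
      case (Suc k)
      then have "(\<lambda>x. \<Sum>i<k. c i * u i x) \<in> W" "u k \<in> W" using uW' by (auto simp: W'_def)
      then show ?case using function_spaceD(2)[OF insert.prems(2)] by simp
    qed
    define z where "z x = v x + (\<Sum>i<m. a i * u i x)" for x
    have zW: "z \<in> W"
      using function_spaceD(2)[OF insert.prems(2) v(1) lin[OF order_refl], of 1] by (simp add: z_def[abs_def])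
    have zb: "z b = v b" using uW' by (simp add: z_def W'_def)
    have zorth: "(\<Sum>x\<in>F. z x * cnj (u j x)) = 0" if "j < m" for j
    proof -
      have "(\<Sum>x\<in>F. z x * cnj (u j x)) = (\<Sum>x\<in>F. v x * cnj (u j x)) +
        (\<Sum>x\<in>F. \<Sum>i<m. a i * (u i x * cnj (u j x)))"
        by (simp add: z_def distrib_right sum.distrib sum_distrib_right mult.assoc)
      also have "(\<Sum>x\<in>F. \<Sum>i<m. a i * (u i x * cnj (u j x)))
        = (\<Sum>i<m. a i * (\<Sum>x\<in>F. u i x * cnj (u j x)))"
        by (subst sum.swap) (simp add: sum_distrib_left)
      also have "\<dots> = (\<Sum>i<m. if i = j then a i else 0)"
        by (intro sum.cong) (use orth that in auto)
      also have "\<dots> = a j" using that by simp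
      finally show ?thesis by (simp add: a_def)
    qed
    have zorth': "(\<Sum>x\<in>F. u j x * cnj (z x)) = 0" if "j < m" for j
      using zorth[OF that, THEN arg_cong[of _ _ cnj]] by (simp add: mult.commute)
    define s where "s = (\<Sum>x\<in>F. (cmod (z x))\<^sup>2)"
    have "(cmod (z b))\<^sup>2 \<le> s" unfolding s_def
      by (rule member_le_sum) (use insert.prems(1) \<open>finite F\<close> in auto)
    then have s: "s > 0" using zb v by (smt (verit) zero_less_norm_iff zero_less_power)
    define z' where "z' x = complex_of_real (1 / sqrt s) * z x" for x
    have z'W: "z' \<in> W" unfolding z'_def[abs_def] by (intro function_spaceD(3)[OF insert.prems(2)] zW)
    have z'b: "z' b \<noteq> 0" using zb v s by (simp add: z'_def)
    have n1: "(\<Sum>x\<in>F. z' x * cnj (z' x)) = 1"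
    proof -
      have "(\<Sum>x\<in>F. z' x * cnj (z' x)) = (\<Sum>x\<in>F. complex_of_real (1 / s * (cmod (z x))\<^sup>2))"
      proof (intro sum.cong refl)
        fix x
        have "z' x * cnj (z' x) = complex_of_real ((cmod (z' x))\<^sup>2)"
          by (rule complex_norm_square[symmetric])
        also have "(cmod (z' x))\<^sup>2 = 1 / s * (cmod (z x))\<^sup>2"
          using s by (simp add: z'_def norm_mult norm_divide power_mult_distrib power_divide)
        finally show "z' x * cnj (z' x) = complex_of_real (1 / s * (cmod (z x))\<^sup>2)" .
      qed
      also have "\<dots> = complex_of_real (1 / s * s)"
        unfolding s_def sum_distrib_left of_real_sum ..
      finally show ?thesis using s by simp
    qed
    have "(\<Sum>x\<in>F. z' x * cnj (u j x)) = complex_of_real (1 / sqrt s) * (\<Sum>x\<in>F. z x * cnj (u j x))" for j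
      unfolding sum_distrib_left by (rule sum.cong) (simp_all add: z'_def)
    moreover have "(\<Sum>x\<in>F. u j x * cnj (z' x)) = complex_of_real (1 / sqrt s) * (\<Sum>x\<in>F. u j x * cnj (z x))" for j
      unfolding sum_distrib_left by (rule sum.cong) (simp_all add: z'_def)
    ultimately have n2: "(\<Sum>x\<in>F. z' x * cnj (u j x)) = 0" "(\<Sum>x\<in>F. u j x * cnj (z' x)) = 0" if "j < m" for j
      using zorth[OF that] zorth'[OF that] by simp_all
    define u' where "u' i = (if i < m then u i else z')" for i
    show ?thesis
    proof (intro exI[of _ "Suc m"] exI[of _ u'] conjI allI impI ballI)
      show "Suc m \<le> card (insert b B)" using m insert.hyps by simp
      show "u' i \<in> W" for i using uW' z'W by (auto simp: u'_def W'_def)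
      show "(\<Sum>x\<in>F. u' i x * cnj (u' j x)) = (if i = j then 1 else 0)" if "i < Suc m" "j < Suc m" for i j
        using that orth[of i j] n1 n2[of i] n2[of j] by (auto simp: u'_def)
      fix f assume f: "f \<in> W"
      define g where "g x = f x + (- (f b / z' b)) * z' x" for x
      have "g \<in> W" unfolding g_def[abs_def] by (intro function_spaceD(2)[OF insert.prems(2)] f z'W)
      moreover have "g b = 0" using z'b by (simp add: g_def)
      ultimately have "g \<in> W'" by (simp add: W'_def)
      then obtain c where c: "\<forall>x\<in>F. g x = (\<Sum>i<m. c i * u i x)" using span by blast
      show "\<exists>c. \<forall>x\<in>F. f x = (\<Sum>i<Suc m. c i * u' i x)"
      proof (intro exI[of _ "\<lambda>i. if i < m then c i else f b / z' b"] ballI)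
        fix x assume "x \<in> F"
        then have "f x = (\<Sum>i<m. c i * u i x) + f b / z' b * z' x"
          using c by (simp add: g_def algebra_simps)
        also have "(\<Sum>i<m. c i * u i x) = (\<Sum>i<m. (if i < m then c i else f b / z' b) * u' i x)"
          by (intro sum.cong) (auto simp: u'_def)
        finally show "f x = (\<Sum>i<Suc m. (if i < m then c i else f b / z' b) * u' i x)"
          by (simp add: u'_def)
      qed
    qed
  qed
qed

text \<open>
  For an orthonormal basis \<open>u\<close> of \<open>W\<close> restricted to \<open>F\<close>, Cauchy--Schwarz bounds \<open>(cmod (f x))\<^sup>2\<close> by
  \<open>\<Sum>i. (cmod (u i x))\<^sup>2\<close> for every unit vector \<open>f\<close>. Summed over \<open>x\<close>, this expression is the number of
  basis vectors.
\<close>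

lemma determining_set_card_bound:
  fixes W :: "('x \<Rightarrow> complex) set"
  assumes "finite F" "B \<subseteq> F" "F0 \<subseteq> F"
    and W: "function_space W"
    and det: "\<forall>f\<in>W. (\<forall>x\<in>B. f x = 0) \<longrightarrow> (\<forall>x\<in>F. f x = 0)"
    and peak: "\<And>x. x \<in> F0 \<Longrightarrow> \<exists>f\<in>W. (\<Sum>y\<in>F. (cmod (f y))\<^sup>2) \<le> 1 \<and> d \<le> (cmod (f x))\<^sup>2"
  shows "d * card F0 \<le> card B"
proof -
  obtain m :: nat and u where m: "m \<le> card B" and uW: "\<And>i. i < m \<Longrightarrow> u i \<in> W"
    and orth: "\<And>i j. i < m \<Longrightarrow> j < m \<Longrightarrow> (\<Sum>x\<in>F. u i x * cnj (u j x)) = (if i = j then 1 else 0)"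
    and span: "\<And>f. f \<in> W \<Longrightarrow> \<exists>c. \<forall>x\<in>F. f x = (\<Sum>i<m. c i * u i x)"
    using orthonormal_basis_from_determining_set[OF assms(1) finite_subset[OF assms(2,1)] assms(2) W det]
    by (elim exE conjE) blast
  have pt: "d \<le> (\<Sum>i<m. (cmod (u i x))\<^sup>2)" if "x \<in> F0" for x
  proof -
    from peak[OF that] obtain f where f: "f \<in> W" "(\<Sum>y\<in>F. (cmod (f y))\<^sup>2) \<le> 1" "d \<le> (cmod (f x))\<^sup>2"
      by blast
    obtain c where c: "\<And>y. y \<in> F \<Longrightarrow> f y = (\<Sum>i<m. c i * u i y)" using span[OF f(1)] by blast
    have "complex_of_real (\<Sum>y\<in>F. (cmod (f y))\<^sup>2) = (\<Sum>y\<in>F. f y * cnj (f y))"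
      by (simp flip: complex_norm_square)
    also have "\<dots> = (\<Sum>y\<in>F. \<Sum>i<m. \<Sum>j<m. c i * cnj (c j) * (u i y * cnj (u j y)))"
      by (intro sum.cong refl) (simp only: c sum_product cnj_sum complex_cnj_mult mult_ac)
    also have "\<dots> = (\<Sum>i<m. \<Sum>j<m. c i * cnj (c j) * (\<Sum>y\<in>F. u i y * cnj (u j y)))"
      unfolding sum_distrib_left
      by (subst sum.swap, intro sum.cong refl, rule sum.swap)
    also have "\<dots> = (\<Sum>i<m. \<Sum>j<m. if i = j then c i * cnj (c j) else 0)"
      by (intro sum.cong refl) (use orth in auto)
    also have "\<dots> = complex_of_real (\<Sum>i<m. (cmod (c i))\<^sup>2)"
      by (simp add: sum.delta flip: complex_norm_square)
    finally have "(\<Sum>y\<in>F. (cmod (f y))\<^sup>2) = (\<Sum>i<m. (cmod (c i))\<^sup>2)"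
      by (simp only: of_real_eq_iff)
    then have c1: "(\<Sum>i<m. (cmod (c i))\<^sup>2) \<le> 1" using f(2) by simp
    have "cmod (f x) \<le> (\<Sum>i<m. cmod (c i) * cmod (u i x))"
      using c[of x] that assms(3) by (simp add: subset_iff) (metis (no_types, lifting) norm_mult sum_norm_le order_refl)
    then have "(cmod (f x))\<^sup>2 \<le> (\<Sum>i<m. cmod (c i) * cmod (u i x))\<^sup>2"
      by (intro power_mono) auto
    also have "\<dots> \<le> (\<Sum>i<m. (cmod (c i))\<^sup>2) * (\<Sum>i<m. (cmod (u i x))\<^sup>2)"
      by (rule Cauchy_Schwarz_ineq_sum)
    also have "\<dots> \<le> 1 * (\<Sum>i<m. (cmod (u i x))\<^sup>2)"
      by (intro mult_right_mono c1 sum_nonneg) auto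
    finally show ?thesis using f(3) by simp
  qed
  have "d * card F0 = (\<Sum>x\<in>F0. d)" by simp
  also have "\<dots> \<le> (\<Sum>x\<in>F0. \<Sum>i<m. (cmod (u i x))\<^sup>2)" by (intro sum_mono pt)
  also have "\<dots> \<le> (\<Sum>x\<in>F. \<Sum>i<m. (cmod (u i x))\<^sup>2)"
    by (rule sum_mono2) (use assms in \<open>auto intro: sum_nonneg\<close>)
  also have "\<dots> = (\<Sum>i<m. \<Sum>x\<in>F. (cmod (u i x))\<^sup>2)" by (rule sum.swap)
  also have "\<dots> = (\<Sum>i<m. 1)"
  proof (intro sum.cong refl)
    fix i assume "i \<in> {..<m}"
    then have "complex_of_real (\<Sum>x\<in>F. (cmod (u i x))\<^sup>2) = 1"
      using orth[of i i] by (simp flip: complex_norm_square)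
    then show "(\<Sum>x\<in>F. (cmod (u i x))\<^sup>2) = 1" by (simp only: of_real_eq_1_iff)
  qed
  also have "\<dots> \<le> card B" using m by simp
  finally show ?thesis .
qed

text \<open>
  The volumes of consecutive boxes have ratio tending to one, so for large \<open>N\<close> the shell between two
  boxes is a negligible part of the larger one.
\<close>

lemma box_growth:
  fixes d C :: real
  assumes "d > 0"
  shows "\<exists>N::nat. C * ((2 * real N + 5) ^ n - (2 * real N + 1) ^ n) < d * (2 * real N + 5) ^ n"
proof -
  have "(\<lambda>N. (2 * real N + 1) / (2 * real N + 5)) \<longlonglongrightarrow> 1" by real_asymp
  then have "(\<lambda>N. C * (1 - ((2 * real N + 1) / (2 * real N + 5)) ^ n)) \<longlonglongrightarrow> C * (1 - 1 ^ n)"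
    by (intro tendsto_intros)
  then have "eventually (\<lambda>N. C * (1 - ((2 * real N + 1) / (2 * real N + 5)) ^ n) < d) sequentially"
    using assms by (intro order_tendstoD) auto
  then obtain N :: nat where "C * (1 - ((2 * real N + 1) / (2 * real N + 5)) ^ n) < d"
    by (auto simp: eventually_sequentially)
  then have "C * (1 - ((2 * real N + 1) / (2 * real N + 5)) ^ n) * (2 * real N + 5) ^ n < d * (2 * real N + 5) ^ n"
    by (intro mult_strict_right_mono) auto
  then show ?thesis by (intro exI[of _ N]) (simp add: power_divide right_diff_distrib left_diff_distrib mult.assoc)
qed


section \<open>Matrices indexed by a finite set\<close>

text \<open>
  Multiplication by a monomial is a translation. This turns multiplication by matrices over the group
  ring into difference operators.
\<close>

lemma lookup_single_mult:
  fixes x :: "'k :: ab_group_add \<Rightarrow>\<^sub>0 'c :: comm_ring_1"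
  shows "Poly_Mapping.lookup (Poly_Mapping.single t c * x) k = c * Poly_Mapping.lookup x (k - t)"
proof -
  have eq: "(k = t + q) = (k - t = q)" for q by (auto simp: algebra_simps)
  show ?thesis
    by (simp add: lookup_mult lookup_single when_mult eq)
qed

text \<open>
  The vertices carry no order, so the determinant is indexed by them directly; the matrices of the
  library, indexed by an initial segment of \<open>nat\<close>, serve through an enumeration.
\<close>

definition set_det :: "'v set \<Rightarrow> ('v \<Rightarrow> 'v \<Rightarrow> 'r) \<Rightarrow> 'r :: comm_ring_1" where
  "set_det V a = (\<Sum>\<sigma> | \<sigma> permutes V. of_int (sign \<sigma>) * (\<Prod>v\<in>V. a v (\<sigma> v)))"

lemma set_det_eq_det:
  fixes a :: "'v \<Rightarrow> 'v \<Rightarrow> 'r :: comm_ring_1"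
  assumes h: "bij_betw h {0..<n} V"
  shows "set_det V a = det (mat n n (\<lambda>(i, j). a (h i) (h j)))"
proof -
  have inj: "inj_on h {0..<n}" and V: "h ` {0..<n} = V" using h by (auto simp: bij_betw_def)
  have bij: "bij_betw (map_permutation {0..<n} h) {p. p permutes {0..<n}} {p. p permutes V}"
  proof (rule bij_betw_cong[THEN iffD1, OF _ bij_betw_permutations[OF h]])
    show "(\<lambda>x. if x \<in> V then h (p (inv_into {0..<n} h x)) else x) = map_permutation {0..<n} h p" for p
      by (simp add: map_permutation_def restrict_id_def V fun_eq_iff)
  qed
  have "set_det V a = (\<Sum>p | p permutes {0..<n}. of_int (sign (map_permutation {0..<n} h p)) *
      (\<Prod>v\<in>V. a v (map_permutation {0..<n} h p v)))"
    unfolding set_det_def by (rule sum.reindex_bij_betw[OF bij, symmetric])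
  also have "\<dots> = (\<Sum>p | p permutes {0..<n}. signof p * (\<Prod>i = 0..<n. a (h i) (h (p i))))"
  proof (intro sum.cong refl arg_cong2[of _ _ _ _ "(*)"])
    fix p assume "p \<in> {p. p permutes {0..<n}}"
    then have p: "p permutes {0..<n}" by simp
    show "of_int (sign (map_permutation {0..<n} h p)) = signof p"
      using sign_map_permutation[OF inj p finite_atLeastLessThan] by (simp add: sign_def)
    have "(\<Prod>v\<in>V. a v (map_permutation {0..<n} h p v)) =
        (\<Prod>i = 0..<n. a (h i) (map_permutation {0..<n} h p (h i)))"
      by (rule prod.reindex_bij_betw[OF h, symmetric])
    also have "\<dots> = (\<Prod>i = 0..<n. a (h i) (h (p i)))"
      by (intro prod.cong refl) (simp add: map_permutation_apply[OF inj])
    finally show "(\<Prod>v\<in>V. a v (map_permutation {0..<n} h p v)) = (\<Prod>i = 0..<n. a (h i) (h (p i)))" .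
  qed
  also have "\<dots> = det (mat n n (\<lambda>(i, j). a (h i) (h j)))"
    by (subst det_def'[of _ n]) (auto intro!: sum.cong prod.cong simp: permutes_in_image)
  finally show ?thesis .
qed

lemma set_det_eq_0_iff:
  fixes a :: "'v \<Rightarrow> 'v \<Rightarrow> 'r :: idom"
  assumes "finite V"
  shows "set_det V a = 0 \<longleftrightarrow> (\<exists>x. (\<exists>v\<in>V. x v \<noteq> 0) \<and> (\<forall>u\<in>V. (\<Sum>v\<in>V. a u v * x v) = 0))"
proof -
  obtain h where h: "bij_betw h {0..<card V} V"
    using ex_bij_betw_nat_finite[OF assms] by blast
  define n where "n = card V"
  note h = h[folded n_def]
  define A where "A = mat n n (\<lambda>(i, j). a (h i) (h j))"
  have hV: "h i \<in> V" if "i < n" for i using bij_betw_apply[OF h, of i] that by simp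
  have hV': "\<exists>i<n. v = h i" if "v \<in> V" for v using h that by (auto simp: bij_betw_def)
  have sum_h: "(\<Sum>v\<in>V. g v) = (\<Sum>j = 0..<n. g (h j))" for g :: "'v \<Rightarrow> 'r"
    by (rule sum.reindex_bij_betw[OF h, symmetric])
  have "set_det V a = 0 \<longleftrightarrow> (\<exists>y. y \<in> carrier_vec n \<and> y \<noteq> 0\<^sub>v n \<and> A *\<^sub>v y = 0\<^sub>v n)"
    unfolding set_det_eq_det[OF h] A_def[symmetric]
    by (rule det_0_iff_vec_prod_zero) (simp add: A_def)
  also have "\<dots> \<longleftrightarrow> (\<exists>x. (\<exists>v\<in>V. x v \<noteq> 0) \<and> (\<forall>u\<in>V. (\<Sum>v\<in>V. a u v * x v) = 0))"
  proof
    assume "\<exists>y. y \<in> carrier_vec n \<and> y \<noteq> 0\<^sub>v n \<and> A *\<^sub>v y = 0\<^sub>v n"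
    then obtain y where y: "y \<in> carrier_vec n" "y \<noteq> 0\<^sub>v n" "A *\<^sub>v y = 0\<^sub>v n" by blast
    define x where "x v = y $ (the_inv_into {0..<n} h v)" for v
    have xh: "x (h i) = y $ i" if "i < n" for i
      using that h by (simp add: x_def bij_betw_def the_inv_into_f_f)
    obtain i where i: "i < n" "y $ i \<noteq> 0" using y(1,2) by (auto simp: vec_eq_iff)
    have "(\<Sum>v\<in>V. a u v * x v) = 0" if "u \<in> V" for u
    proof -
      from hV'[OF that] obtain k where k: "k < n" "u = h k" by blast
      have "(\<Sum>v\<in>V. a u v * x v) = (\<Sum>j = 0..<n. a (h k) (h j) * y $ j)"
        unfolding sum_h by (intro sum.cong) (auto simp: k xh)
      also have "\<dots> = (A *\<^sub>v y) $ k"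
        using k y(1) by (simp add: A_def scalar_prod_def)
      finally show ?thesis using y(3) k by simp
    qed
    then show "\<exists>x. (\<exists>v\<in>V. x v \<noteq> 0) \<and> (\<forall>u\<in>V. (\<Sum>v\<in>V. a u v * x v) = 0)"
      using i xh[OF i(1)] hV[OF i(1)] by metis
  next
    assume "\<exists>x. (\<exists>v\<in>V. x v \<noteq> 0) \<and> (\<forall>u\<in>V. (\<Sum>v\<in>V. a u v * x v) = 0)"
    then obtain x v where x: "v \<in> V" "x v \<noteq> 0" "\<And>u. u \<in> V \<Longrightarrow> (\<Sum>v\<in>V. a u v * x v) = 0" by blast
    define y where "y = vec n (\<lambda>i. x (h i))"
    from hV'[OF x(1)] obtain k where k: "k < n" "v = h k" by blast
    have "y \<noteq> 0\<^sub>v n" using k x(2) by (auto simp: y_def vec_eq_iff)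
    moreover have "A *\<^sub>v y = 0\<^sub>v n"
    proof (rule eq_vecI)
      fix i assume "i < dim_vec (0\<^sub>v n :: 'r vec)"
      then have i: "i < n" by simp
      have "(A *\<^sub>v y) $ i = (\<Sum>j = 0..<n. a (h i) (h j) * x (h j))"
        using i by (simp add: A_def y_def scalar_prod_def)
      also have "\<dots> = 0" using x(3)[OF hV[OF i]] by (simp add: sum_h)
      finally show "(A *\<^sub>v y) $ i = 0\<^sub>v n $ i" using i by simp
    qed (simp add: A_def)
    ultimately show "\<exists>y. y \<in> carrier_vec n \<and> y \<noteq> 0\<^sub>v n \<and> A *\<^sub>v y = 0\<^sub>v n"
      by (intro exI[of _ y]) (simp add: y_def)
  qed
  finally show ?thesis .
qed


section \<open>Eigenfunctions on vertices and chains\<close>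

type_synonym chain = "nat \<Rightarrow>\<^sub>0 int"

text \<open>
  The box of side \<open>2 * N + 1\<close> around the origin of the lattice spanned by the first \<open>n\<close> coordinates.
\<close>

definition box :: "nat \<Rightarrow> nat \<Rightarrow> chain set" where
  "box n N = {k. (\<forall>i. \<bar>Poly_Mapping.lookup k i\<bar> \<le> int N) \<and> (\<forall>i\<ge>n. Poly_Mapping.lookup k i = 0)}"

lemma finite_card_box: "finite (box n N) \<and> card (box n N) = (2 * N + 1) ^ n"
proof -
  have "bij_betw (\<lambda>k. restrict (Poly_Mapping.lookup k) {..<n}) (box n N) (PiE {..<n} (\<lambda>_. {- int N..int N}))"
  proof (rule bij_betwI[where g = "\<lambda>g. Abs_poly_mapping (\<lambda>i. if i < n then g i else 0)"])
    have fin: "finite {i. (if i < n then g i else 0) \<noteq> 0}" for g :: "nat \<Rightarrow> int"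
      by (rule finite_subset[of _ "{..<n}"]) (auto split: if_splits)
    then have lk: "Poly_Mapping.lookup (Abs_poly_mapping (\<lambda>i. if i < n then g i else 0)) =
        (\<lambda>i. if i < n then g i else 0)" for g :: "nat \<Rightarrow> int"
      by simp
    show "(\<lambda>g. Abs_poly_mapping (\<lambda>i. if i < n then g i else 0)) \<in> (PiE {..<n} (\<lambda>_. {- int N..int N})) \<rightarrow> box n N"
    proof
      fix g assume g: "g \<in> PiE {..<n} (\<lambda>_. {- int N..int N})"
      have "\<bar>g i\<bar> \<le> int N" if "i < n" for i
        using PiE_mem[OF g, of i] that by auto
      then show "Abs_poly_mapping (\<lambda>i. if i < n then g i else 0) \<in> box n N"
        by (simp add: box_def lk)
    qed
    show "(\<lambda>k. restrict (Poly_Mapping.lookup k) {..<n}) \<in> box n N \<rightarrow> (PiE {..<n} (\<lambda>_. {- int N..int N}))"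
    proof
      fix k assume "k \<in> box n N"
      then have "\<bar>Poly_Mapping.lookup k i\<bar> \<le> int N" for i by (simp add: box_def)
      then have "- int N \<le> Poly_Mapping.lookup k i \<and> Poly_Mapping.lookup k i \<le> int N" for i
        by (simp add: abs_le_iff minus_le_iff)
      then show "restrict (Poly_Mapping.lookup k) {..<n} \<in> PiE {..<n} (\<lambda>_. {- int N..int N})"
        by (intro restrict_PiE_iff[THEN iffD2]) simp
    qed
    show "Abs_poly_mapping (\<lambda>i. if i < n then restrict (Poly_Mapping.lookup k) {..<n} i else 0) = k"
      if "k \<in> box n N" for k
      by (rule poly_mapping_eqI) (use that in \<open>auto simp: lk box_def\<close>)
    show "restrict (Poly_Mapping.lookup (Abs_poly_mapping (\<lambda>i. if i < n then g i else 0))) {..<n} = g"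
      if "g \<in> PiE {..<n} (\<lambda>_. {- int N..int N})" for g
      using that by (auto simp: lk PiE_iff extensional_def fun_eq_iff)
  qed
  then have "finite (box n N) = finite (PiE {..<n} (\<lambda>_. {- int N..int N}))"
    "card (box n N) = card (PiE {..<n} (\<lambda>_. {- int N..int N}))"
    by (auto simp: bij_betw_finite bij_betw_same_card)
  then show ?thesis by (simp add: card_PiE finite_PiE nat_add_distrib nat_mult_distrib flip: mult_2)
qed

lemma box_mono: "N \<le> M \<Longrightarrow> box n N \<subseteq> box n M"
proof
  fix k assume "N \<le> M" "k \<in> box n N"
  then have "\<bar>Poly_Mapping.lookup k i\<bar> \<le> int M" for i
    using order_trans[of "\<bar>Poly_Mapping.lookup k i\<bar>" "int N" "int M"] by (simp add: box_def)
  with \<open>k \<in> box n N\<close> show "k \<in> box n M" by (simp add: box_def)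
qed

text \<open>
  The injection \<open>\<nu>\<close> names the coordinates of chains by natural numbers: finitely supported functions on
  \<open>nat\<close> form a linearly ordered group, and the library makes the group ring of such a group an
  integral domain.
\<close>

locale weighted_graph = fin_digraph G + bidirected_digraph G arev
  for G :: "('v, 'e) pre_digraph" and arev +
  fixes w :: "'e \<Rightarrow> complex" and pot :: "'v \<Rightarrow> real" and l :: real and \<nu> :: "'e \<Rightarrow> nat"
  assumes \<nu>_inj: "inj_on \<nu> (arcs G)"
    and w_nz: "e \<in> arcs G \<Longrightarrow> w e \<noteq> 0"
begin

text \<open>
  Each undirected edge occupies the two coordinates of its arcs with opposite signs. This makes the
  chain antisymmetric under reversal without choosing an orientation of the edge.
\<close>

definition arc_chain :: "'e \<Rightarrow> chain" where
  "arc_chain e = Poly_Mapping.single (\<nu> e) 1 - Poly_Mapping.single (\<nu> (arev e)) 1"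

lemma arc_chain_arev: "arc_chain (arev e) = - arc_chain e"
  by (simp add: arc_chain_def)

lemma lookup_arc_chain:
  assumes "x \<in> arcs G" "e \<in> arcs G"
  shows "Poly_Mapping.lookup (arc_chain x) (\<nu> e) = (if x = e then 1 else 0) - (if x = arev e then 1 else 0)"
proof -
  have "\<nu> x = \<nu> e \<longleftrightarrow> x = e" by (rule inj_on_eq_iff[OF \<nu>_inj assms])
  moreover have "\<nu> (arev x) = \<nu> e \<longleftrightarrow> x = arev e"
    using inj_on_eq_iff[OF \<nu>_inj arev_in_arcs[OF assms(1)] assms(2)] by (metis arev_arev)
  ultimately show ?thesis by (simp only: arc_chain_def lookup_minus lookup_single when_def)
qed

text \<open>
  The periodic graph has an arc from \<open>(u, k)\<close> to \<open>(head G e, k - arc_chain e)\<close> for every arc \<open>e\<close>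
  leaving \<open>u\<close>. The minus sign is the one in the coefficients of a product with the monomial of
  \<open>arc_chain e\<close>.
\<close>

definition eigen_equation :: "('v \<times> chain \<Rightarrow> complex) \<Rightarrow> 'v \<Rightarrow> chain \<Rightarrow> bool" where
  "eigen_equation f u k \<longleftrightarrow>
     (\<Sum>e\<in>out_arcs G u. w e * f (head G e, k - arc_chain e)) + complex_of_real (pot u) * f (u, k) = complex_of_real l * f (u, k)"

definition eigenfunction :: "('v \<times> chain \<Rightarrow> complex) \<Rightarrow> bool" where
  "eigenfunction f \<longleftrightarrow> (\<forall>u\<in>verts G. \<forall>k. eigen_equation f u k)"

lemma eigenfunction_translate: "eigenfunction f \<Longrightarrow> eigenfunction (\<lambda>(v, k). f (v, k + t))"
  by (simp add: eigenfunction_def eigen_equation_def diff_add_eq)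

lemma eigenfunction_combination:
  assumes "eigenfunction f" "eigenfunction g"
  shows "eigenfunction (\<lambda>x. f x + c * g x)"
  unfolding eigenfunction_def
proof (intro ballI allI)
  fix u k assume u: "u \<in> verts G"
  have f: "(\<Sum>e\<in>out_arcs G u. w e * f (head G e, k - arc_chain e)) + complex_of_real (pot u) * f (u, k) = complex_of_real l * f (u, k)"
    and g: "(\<Sum>e\<in>out_arcs G u. w e * g (head G e, k - arc_chain e)) + complex_of_real (pot u) * g (u, k) = complex_of_real l * g (u, k)"
    using assms u by (auto simp: eigenfunction_def eigen_equation_def)
  have "(\<Sum>e\<in>out_arcs G u. w e * (f (head G e, k - arc_chain e) + c * g (head G e, k - arc_chain e))) =
    (\<Sum>e\<in>out_arcs G u. w e * f (head G e, k - arc_chain e)) + c * (\<Sum>e\<in>out_arcs G u. w e * g (head G e, k - arc_chain e))"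
    by (simp add: distrib_left sum.distrib sum_distrib_left mult.left_commute)
  moreover have "(\<Sum>e\<in>out_arcs G u. w e * f (head G e, k - arc_chain e)) = l * f (u, k) - pot u * f (u, k)"
    "(\<Sum>e\<in>out_arcs G u. w e * g (head G e, k - arc_chain e)) = l * g (u, k) - pot u * g (u, k)"
    using f g by (simp_all add: eq_diff_eq)
  ultimately show "eigen_equation (\<lambda>x. f x + c * g x) u k"
    by (simp add: eigen_equation_def algebra_simps)
qed

definition chain_dim :: nat where "chain_dim = Suc (Max (insert 0 (\<nu> ` arcs G)))"

lemma \<nu>_less_chain_dim: "e \<in> arcs G \<Longrightarrow> \<nu> e < chain_dim"
  unfolding chain_dim_def by (intro le_imp_less_Suc Max_ge) auto

lemma box_step:
  assumes "e \<in> arcs G" "k \<in> box chain_dim N"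
  shows "k + arc_chain e \<in> box chain_dim (Suc N)" "k - arc_chain e \<in> box chain_dim (Suc N)"
proof -
  have "\<bar>Poly_Mapping.lookup (arc_chain e) i\<bar> \<le> 1" "i \<ge> chain_dim \<Longrightarrow> Poly_Mapping.lookup (arc_chain e) i = 0" for i
    using \<nu>_less_chain_dim[OF assms(1)] \<nu>_less_chain_dim[of "arev e"] assms(1)
    by (auto simp: arc_chain_def lookup_minus lookup_single when_def)
  note K = this
  have "\<bar>Poly_Mapping.lookup k i + Poly_Mapping.lookup (arc_chain e) i\<bar> \<le> int (Suc N)"
    "\<bar>Poly_Mapping.lookup k i - Poly_Mapping.lookup (arc_chain e) i\<bar> \<le> int (Suc N)" for i
  proof -
    have "\<bar>Poly_Mapping.lookup k i\<bar> \<le> int N" using assms(2) by (simp add: box_def)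
    then show "\<bar>Poly_Mapping.lookup k i + Poly_Mapping.lookup (arc_chain e) i\<bar> \<le> int (Suc N)"
      "\<bar>Poly_Mapping.lookup k i - Poly_Mapping.lookup (arc_chain e) i\<bar> \<le> int (Suc N)"
      using K(1)[of i] by linarith+
  qed
  then show "k + arc_chain e \<in> box chain_dim (Suc N)" "k - arc_chain e \<in> box chain_dim (Suc N)"
    using assms(2) K(2) by (auto simp: box_def lookup_add lookup_minus)
qed

text \<open>
  The arcs change a coordinate by at most one. Within distance one of the smaller box the equation only
  sees values that are kept or were zero before, and beyond that distance all its values are zero. Hence
  the shell of zeros has to be two layers thick.
\<close>

lemma eigenfunction_cutoff:
  assumes "eigenfunction f"
    and zero: "\<And>v k. v \<in> verts G \<Longrightarrow> k \<in> box chain_dim (N + 2) - box chain_dim N \<Longrightarrow> f (v, k) = 0"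
  shows "eigenfunction (\<lambda>(v, k). if v \<in> verts G \<and> k \<in> box chain_dim N then f (v, k) else 0)"
  unfolding eigenfunction_def
proof (intro ballI allI)
  fix u k assume u: "u \<in> verts G"
  define g where "g = (\<lambda>(v, k). if v \<in> verts G \<and> k \<in> box chain_dim N then f (v, k) else 0)"
  have g_eq: "g (v, k) = f (v, k)" if "v \<in> verts G" "k \<in> box chain_dim (N + 2)" for v k
    using that zero by (auto simp: g_def)
  have out: "e \<in> arcs G" "head G e \<in> verts G" if "e \<in> out_arcs G u" for e
    using that by auto
  show "eigen_equation g u k"
  proof (cases "k \<in> box chain_dim (Suc N)")
    case True
    then have k: "k \<in> box chain_dim (N + 2)" using box_mono[of "Suc N" "N + 2"] by auto
    have "(\<Sum>e\<in>out_arcs G u. w e * g (head G e, k - arc_chain e)) = (\<Sum>e\<in>out_arcs G u. w e * f (head G e, k - arc_chain e))"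
      by (intro sum.cong refl arg_cong[of _ _ "(*) _"] g_eq) (use box_step(2)[OF _ True] out in auto)
    then show ?thesis using assms(1) u k by (simp add: eigenfunction_def eigen_equation_def g_eq)
  next
    case False
    have "k - arc_chain e \<notin> box chain_dim N" if "e \<in> out_arcs G u" for e
      using box_step(1)[OF out(1)[OF that], of "k - arc_chain e" N] False by auto
    then have "g (head G e, k - arc_chain e) = 0" if "e \<in> out_arcs G u" for e
      using that by (simp add: g_def)
    moreover have "k \<notin> box chain_dim N" using False box_mono[of N "Suc N" chain_dim] by auto
    ultimately show ?thesis by (simp add: eigen_equation_def g_def)
  qed
qed

definition square_bounded :: "('v \<times> chain \<Rightarrow> complex) \<Rightarrow> real \<Rightarrow> bool" where
  "square_bounded f C \<longleftrightarrow> (\<forall>S. finite S \<longrightarrow> S \<subseteq> verts G \<times> UNIV \<longrightarrow> (\<Sum>x\<in>S. (cmod (f x))\<^sup>2) \<le> C)"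

lemma square_boundedD:
  "square_bounded f C \<Longrightarrow> finite S \<Longrightarrow> S \<subseteq> verts G \<times> UNIV \<Longrightarrow> (\<Sum>x\<in>S. (cmod (f x))\<^sup>2) \<le> C"
  by (simp add: square_bounded_def)

text \<open>
  If no eigenfunction has finite support, then by \<open>eigenfunction_cutoff\<close> the values in the shell between
  two boxes determine a square bounded eigenfunction on the larger box. But translates and multiples
  of \<open>f\<close> have norm at most one and a fixed positive value at any prescribed point of the box, so the
  shell would contain a fixed fraction of the box.
\<close>

lemma finitely_supported_eigenfunction:
  assumes f: "eigenfunction f" "square_bounded f C" "v0 \<in> verts G" "f (v0, k0) \<noteq> 0"
  obtains g v k where "eigenfunction g" "finite {x. g x \<noteq> 0}" "v \<in> verts G" "g (v, k) \<noteq> 0"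
proof (rule ccontr)
  assume no: "\<not> thesis"
  define W where "W = {g. eigenfunction g \<and> (\<exists>C. square_bounded g C)}"
  have W: "function_space W"
    unfolding function_space_def
  proof (intro conjI ballI allI)
    show "(\<lambda>x. 0) \<in> W"
      by (auto simp: W_def eigenfunction_def eigen_equation_def square_bounded_def intro!: exI[of _ 0])
    fix g h c assume g: "g \<in> W" and h: "h \<in> W"
    obtain C D where C: "square_bounded g C" and D: "square_bounded h D"
      using g h by (auto simp: W_def)
    have pt: "(cmod (g x + c * h x))\<^sup>2 \<le> 2 * (cmod (g x))\<^sup>2 + 2 * (cmod c)\<^sup>2 * (cmod (h x))\<^sup>2" for x
    proof -
      have "(cmod (g x + c * h x))\<^sup>2 \<le> (cmod (g x) + cmod c * cmod (h x))\<^sup>2"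
        by (intro power_mono) (metis norm_triangle_ineq norm_mult, simp)
      also have "\<dots> \<le> 2 * (cmod (g x))\<^sup>2 + 2 * (cmod c * cmod (h x))\<^sup>2"
        using zero_le_power2[of "cmod (g x) - cmod c * cmod (h x)"] by (simp add: power2_eq_square algebra_simps)
      finally show ?thesis by (simp add: power_mult_distrib)
    qed
    have "square_bounded (\<lambda>x. g x + c * h x) (2 * C + 2 * (cmod c)\<^sup>2 * D)"
      unfolding square_bounded_def
    proof (intro allI impI)
      fix S :: "('v \<times> chain) set" assume S: "finite S" "S \<subseteq> verts G \<times> UNIV"
      have "(\<Sum>x\<in>S. (cmod (g x + c * h x))\<^sup>2) \<le> (\<Sum>x\<in>S. 2 * (cmod (g x))\<^sup>2 + 2 * (cmod c)\<^sup>2 * (cmod (h x))\<^sup>2)"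
        by (intro sum_mono pt)
      also have "\<dots> = 2 * (\<Sum>x\<in>S. (cmod (g x))\<^sup>2) + 2 * (cmod c)\<^sup>2 * (\<Sum>x\<in>S. (cmod (h x))\<^sup>2)"
        by (simp add: sum.distrib sum_distrib_left)
      also have "\<dots> \<le> 2 * C + 2 * (cmod c)\<^sup>2 * D"
        by (intro add_mono mult_left_mono square_boundedD[OF C S] square_boundedD[OF D S]) auto
      finally show "(\<Sum>x\<in>S. (cmod (g x + c * h x))\<^sup>2) \<le> 2 * C + 2 * (cmod c)\<^sup>2 * D" .
    qed
    then show "(\<lambda>x. g x + c * h x) \<in> W"
      using g h eigenfunction_combination by (auto simp: W_def)
  qed
  define F where "F N = verts G \<times> box chain_dim N" for N
  have finF: "finite (F N)" for N by (simp add: F_def finite_card_box)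
  have cardF: "card (F N) = card (verts G) * (2 * N + 1) ^ chain_dim" for N
    by (simp add: F_def card_cartesian_product finite_card_box)
  define a where "a = (cmod (f (v0, k0)))\<^sup>2"
  have a: "a > 0" using f(4) by (simp add: a_def)
  have "(\<Sum>x\<in>{(v0, k0)}. (cmod (f x))\<^sup>2) \<le> C"
    by (rule square_boundedD[OF f(2)]) (use f(3) in auto)
  then have "a \<le> C" by (simp add: a_def)
  with a have C: "C > 0" by linarith
  \<comment> \<open>Only the points above \<open>v0\<close> are used as peaks; the factor \<open>card (verts G)\<close> is absorbed in the shell.\<close>
  have bound: "a / C * card (box chain_dim (N + 2)) \<le> card (F (N + 2) - F N)" for N
  proof -
    have "card (box chain_dim (N + 2)) = card ({v0} \<times> box chain_dim (N + 2))"
      by (simp add: card_cartesian_product)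
    moreover have "a / C * card ({v0} \<times> box chain_dim (N + 2)) \<le> card (F (N + 2) - F N)"
    proof (rule determining_set_card_bound[OF finF _ _ W])
      show "{v0} \<times> box chain_dim (N + 2) \<subseteq> F (N + 2)" using f(3) by (auto simp: F_def)
      show "\<forall>g\<in>W. (\<forall>x\<in>F (N + 2) - F N. g x = 0) \<longrightarrow> (\<forall>x\<in>F (N + 2). g x = 0)"
      proof (intro ballI impI, rule ccontr)
        fix g x assume g: "g \<in> W" and z: "\<forall>x\<in>F (N + 2) - F N. g x = 0"
          and x: "x \<in> F (N + 2)" "g x \<noteq> 0"
        define h where "h = (\<lambda>(v, k). if v \<in> verts G \<and> k \<in> box chain_dim N then g (v, k) else 0)"
        have "eigenfunction h" unfolding h_def
          by (rule eigenfunction_cutoff) (use g z in \<open>auto simp: W_def F_def\<close>)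
        moreover have "finite {x. h x \<noteq> 0}"
          by (rule finite_subset[OF _ finF[of N]]) (auto simp: h_def F_def split: if_splits)
        moreover obtain v k where vk: "x = (v, k)" by (cases x)
        moreover from vk x z have "(v, k) \<in> F N" by auto
        then have "v \<in> verts G" "h (v, k) \<noteq> 0" using x vk by (auto simp: F_def h_def)
        ultimately show False using no that by blast
      qed
    next
      fix x assume "x \<in> {v0} \<times> box chain_dim (N + 2)"
      then obtain k where x: "x = (v0, k)" by auto
      define t where "t = k0 - k"
      define g where "g x = complex_of_real (1 / sqrt C) * (case x of (v, k) \<Rightarrow> f (v, k + t))" for x
      have cg: "(cmod (g x))\<^sup>2 = (cmod (f (fst x, snd x + t)))\<^sup>2 / C" for x
        using C by (simp add: g_def norm_mult norm_divide power_mult_distrib power_divide split: prod.split)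
      have gC: "square_bounded g 1"
        unfolding square_bounded_def
      proof (intro allI impI)
        fix S :: "('v \<times> chain) set" assume S: "finite S" "S \<subseteq> verts G \<times> UNIV"
        have "(\<Sum>x\<in>S. (cmod (g x))\<^sup>2) = (\<Sum>x\<in>S. (cmod (f (fst x, snd x + t)))\<^sup>2) / C"
          by (simp add: cg sum_divide_distrib)
        also have "(\<Sum>x\<in>S. (cmod (f (fst x, snd x + t)))\<^sup>2) = (\<Sum>x\<in>(\<lambda>x. (fst x, snd x + t)) ` S. (cmod (f x))\<^sup>2)"
          by (subst sum.reindex) (auto simp: inj_on_def)
        also have "\<dots> \<le> C"
          by (rule square_boundedD[OF f(2)]) (use S in auto)
        finally show "(\<Sum>x\<in>S. (cmod (g x))\<^sup>2) \<le> 1" using C by (simp add: divide_right_mono)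
      qed
      have "eigenfunction (\<lambda>x. (\<lambda>x. 0) x + complex_of_real (1 / sqrt C) * (case x of (v, k) \<Rightarrow> f (v, k + t)))"
        by (intro eigenfunction_combination eigenfunction_translate f) (simp add: eigenfunction_def eigen_equation_def)
      then have "eigenfunction g" by (simp add: g_def[abs_def])
      show "\<exists>f\<in>W. (\<Sum>y\<in>F (N + 2). (cmod (f y))\<^sup>2) \<le> 1 \<and> a / C \<le> (cmod (f x))\<^sup>2"
      proof (intro bexI conjI)
        show "g \<in> W" using gC \<open>eigenfunction g\<close> by (auto simp: W_def)
        show "(\<Sum>y\<in>F (N + 2). (cmod (g y))\<^sup>2) \<le> 1"
          by (rule square_boundedD[OF gC finF]) (auto simp: F_def)
        show "a / C \<le> (cmod (g x))\<^sup>2" by (simp add: cg x a_def t_def)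
      qed
    qed auto
    ultimately show ?thesis by simp
  qed
  obtain N :: nat where N: "card (verts G) * ((2 * real N + 5) ^ chain_dim - (2 * real N + 1) ^ chain_dim)
      < a / C * (2 * real N + 5) ^ chain_dim"
    using box_growth[of "a / C" "card (verts G)" chain_dim] a C by auto
  have "real (card (F (N + 2) - F N)) = real (card (F (N + 2))) - real (card (F N))"
  proof -
    have "F N \<subseteq> F (N + 2)" using box_mono[of N "N + 2" chain_dim] by (auto simp: F_def)
    then show ?thesis
      using finF card_mono[OF finF] by (subst card_Diff_subset) (auto simp: of_nat_diff)
  qed
  then have "real (card (F (N + 2) - F N)) = card (verts G) * ((2 * real N + 5) ^ chain_dim - (2 * real N + 1) ^ chain_dim)"
    by (simp add: cardF algebra_simps)
  with bound[of N] N show False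
    by (simp add: finite_card_box add.commute)
qed

text \<open>
  The matrix \<open>\<lambda> - H\<close> over the group ring of the chains: specialising the monomials by
  characters of the group of chains turns \<open>H\<close> into the Floquet matrices of the periodic operator.
\<close>

definition twisted :: "'v \<Rightarrow> 'v \<Rightarrow> (chain \<Rightarrow>\<^sub>0 complex)" where
  "twisted u v = (if u = v then Poly_Mapping.single 0 (complex_of_real (l - pot u)) else 0)
     - (\<Sum>e | e \<in> arcs G \<and> tail G e = u \<and> head G e = v. Poly_Mapping.single (arc_chain e) (w e))"

lemma lookup_twisted_mult:
  assumes u: "u \<in> verts G"
  shows "Poly_Mapping.lookup (\<Sum>v\<in>verts G. twisted u v * x v) k =
    complex_of_real (l - pot u) * Poly_Mapping.lookup (x u) k
      - (\<Sum>e\<in>out_arcs G u. w e * Poly_Mapping.lookup (x (head G e)) (k - arc_chain e))"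
proof -
  have "(\<Sum>v\<in>verts G. twisted u v * x v) =
    (\<Sum>v\<in>verts G. (if u = v then Poly_Mapping.single 0 (complex_of_real (l - pot u)) * x v else 0))
    - (\<Sum>v\<in>verts G. \<Sum>e | e \<in> arcs G \<and> tail G e = u \<and> head G e = v. Poly_Mapping.single (arc_chain e) (w e) * x v)"
    unfolding twisted_def
    by (simp add: left_diff_distrib sum_subtractf sum_distrib_right if_distrib[of "\<lambda>z. z * _"] cong: if_cong)
  also have "(\<Sum>v\<in>verts G. (if u = v then Poly_Mapping.single 0 (complex_of_real (l - pot u)) * x v else 0))
    = Poly_Mapping.single 0 (complex_of_real (l - pot u)) * x u"
    using u by simp
  also have "(\<Sum>v\<in>verts G. \<Sum>e | e \<in> arcs G \<and> tail G e = u \<and> head G e = v. Poly_Mapping.single (arc_chain e) (w e) * x v)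
    = (\<Sum>v\<in>verts G. \<Sum>e | e \<in> out_arcs G u \<and> head G e = v. Poly_Mapping.single (arc_chain e) (w e) * x (head G e))"
    by (intro sum.cong) auto
  also have "\<dots> = (\<Sum>e\<in>out_arcs G u. Poly_Mapping.single (arc_chain e) (w e) * x (head G e))"
    by (rule sum.group) auto
  finally show ?thesis
    by (simp add: lookup_minus lookup_sum lookup_single_mult)
qed

text \<open>
  By \<open>lookup_twisted_mult\<close>, the coefficients of a vector in the kernel of \<open>twisted\<close> are the values of a
  finitely supported eigenfunction.
\<close>

lemma finite_eigenfunction_iff_det:
  "(\<exists>g v k. eigenfunction g \<and> finite {x. g x \<noteq> 0} \<and> v \<in> verts G \<and> g (v, k) \<noteq> 0)
    \<longleftrightarrow> set_det (verts G) twisted = 0"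
proof -
  have ker: "(\<forall>u\<in>verts G. (\<Sum>v\<in>verts G. twisted u v * x v) = 0) \<longleftrightarrow> eigenfunction (\<lambda>(v, k). Poly_Mapping.lookup (x v) k)" for x
  proof -
    have "Poly_Mapping.lookup (\<Sum>v\<in>verts G. twisted u v * x v) k = 0 \<longleftrightarrow>
        eigen_equation (\<lambda>(v, k). Poly_Mapping.lookup (x v) k) u k" if "u \<in> verts G" for u k
      unfolding lookup_twisted_mult[OF that] eigen_equation_def by (auto simp: left_diff_distrib algebra_simps)
    then show ?thesis
      unfolding eigenfunction_def poly_mapping_eq_iff[of _ 0] fun_eq_iff lookup_zero by (intro ball_cong all_cong1) auto
  qed
  show ?thesis
    unfolding set_det_eq_0_iff[OF finite_verts] ker
  proof (intro iffI; elim exE conjE bexE)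
    fix g v k assume g: "eigenfunction g" "finite {x. g x \<noteq> 0}" "v \<in> verts G" "g (v, k) \<noteq> 0"
    define x where "x v = Abs_poly_mapping (\<lambda>k. g (v, k))" for v
    have "finite {k. g (v, k) \<noteq> 0}" for v
      by (rule finite_subset[OF _ finite_imageI[OF g(2), of snd]]) force
    then have lk: "Poly_Mapping.lookup (x v) = (\<lambda>k. g (v, k))" for v by (simp add: x_def)
    show "\<exists>x. (\<exists>v\<in>verts G. x v \<noteq> 0) \<and> eigenfunction (\<lambda>(v, k). Poly_Mapping.lookup (x v) k)"
      using g by (intro exI[of _ x]) (auto simp: lk poly_mapping_eq_iff fun_eq_iff)
  next
    fix x v assume x: "eigenfunction (\<lambda>(v, k). Poly_Mapping.lookup (x v) k)" "v \<in> verts G" "x v \<noteq> 0"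
    define g where "g = (\<lambda>(v, k). if v \<in> verts G then Poly_Mapping.lookup (x v) k else 0)"
    have "(\<Sum>e\<in>out_arcs G u. w e * g (head G e, k - arc_chain e)) =
        (\<Sum>e\<in>out_arcs G u. w e * Poly_Mapping.lookup (x (head G e)) (k - arc_chain e))" for u k
      by (intro sum.cong) (auto simp: g_def)
    then have "eigenfunction g"
      using x(1) by (simp add: eigenfunction_def eigen_equation_def) (simp add: g_def)
    moreover have "finite {x. g x \<noteq> 0}"
      by (rule finite_subset[of _ "Sigma (verts G) (\<lambda>v. Poly_Mapping.keys (x v))"])
        (auto simp: g_def in_keys_iff split: if_splits)
    moreover obtain k where "Poly_Mapping.lookup (x v) k \<noteq> 0"
      using x(3) by (auto simp: poly_mapping_eq_iff fun_eq_iff)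
    ultimately show "\<exists>g v k. eigenfunction g \<and> finite {x. g x \<noteq> 0} \<and> v \<in> verts G \<and> g (v, k) \<noteq> 0"
      using x(2) by (intro exI[of _ g] exI[of _ v] exI[of _ k]) (simp add: g_def)
  qed
qed

end


section \<open>The determinant as a sum over cyclic arc sets\<close>

context weighted_graph
begin

text \<open>
  The arcs of a partial permutation of the vertices: vertex-disjoint directed cycles, among which are
  loops and the 2-cycles that consist of an arc and its reverse.
\<close>

definition cyclic :: "'e set \<Rightarrow> bool" where
  "cyclic S \<longleftrightarrow> S \<subseteq> arcs G \<and> inj_on (tail G) S \<and> inj_on (head G) S \<and> tail G ` S = head G ` S"

definition out_arc :: "'e set \<Rightarrow> 'v \<Rightarrow> 'e option" where
  "out_arc S v = (if v \<in> tail G ` S then Some (the_inv_into S (tail G) v) else None)"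

definition next_vertex :: "'e set \<Rightarrow> 'v \<Rightarrow> 'v" where
  "next_vertex S v = (case out_arc S v of None \<Rightarrow> v | Some e \<Rightarrow> head G e)"

lemma cyclicD:
  assumes "cyclic S"
  shows "S \<subseteq> arcs G" "inj_on (tail G) S" "inj_on (head G) S" "tail G ` S = head G ` S" "finite S"
  using assms finite_subset[of S "arcs G"] by (auto simp: cyclic_def)

lemma out_arc_tail: "cyclic S \<Longrightarrow> e \<in> S \<Longrightarrow> out_arc S (tail G e) = Some e"
  by (simp add: out_arc_def the_inv_into_f_f cyclicD(2))

lemma out_arc_eq_Some:
  assumes "cyclic S"
  shows "out_arc S v = Some e \<longleftrightarrow> e \<in> S \<and> tail G e = v"
proof
  assume "out_arc S v = Some e"
  then obtain e' where "e' \<in> S" "v = tail G e'" by (auto simp: out_arc_def split: if_splits)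
  with \<open>out_arc S v = Some e\<close> show "e \<in> S \<and> tail G e = v" using out_arc_tail[OF assms] by auto
qed (use out_arc_tail[OF assms] in auto)

lemma out_arc_eq_None: "out_arc S v = None \<longleftrightarrow> v \<notin> tail G ` S"
  by (simp add: out_arc_def)

lemma next_vertex_tail: "cyclic S \<Longrightarrow> e \<in> S \<Longrightarrow> next_vertex S (tail G e) = head G e"
  by (simp add: next_vertex_def out_arc_tail)

lemma next_vertex_fixed: "v \<notin> tail G ` S \<Longrightarrow> next_vertex S v = v"
  by (simp add: next_vertex_def out_arc_def)

lemma next_vertex_permutes:
  assumes "cyclic S"
  shows "next_vertex S permutes verts G"
proof (rule permutes_subset)
  show "next_vertex S permutes tail G ` S"
  proof (rule bij_imp_permutes)
    have "inj_on (next_vertex S) (tail G ` S)"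
      using cyclicD(3)[OF assms] by (auto simp: next_vertex_tail[OF assms] inj_on_def)
    moreover have "next_vertex S ` tail G ` S = head G ` S"
      by (simp add: image_image next_vertex_tail[OF assms])
    ultimately show "bij_betw (next_vertex S) (tail G ` S) (tail G ` S)"
      using cyclicD(4)[OF assms] by (simp add: bij_betw_def)
  qed (rule next_vertex_fixed)
  show "tail G ` S \<subseteq> verts G" using cyclicD(1)[OF assms] by auto
qed

text \<open>
  A term of the expanded Leibniz formula selects in the row of each vertex \<open>v\<close> either the diagonal
  entry, if \<open>\<sigma>\<close> fixes \<open>v\<close>, or an arc from \<open>v\<close> to \<open>\<sigma> v\<close>. The selected arcs form a cyclic set, and they
  determine both the selection and \<open>\<sigma>\<close>.
\<close>

lemma Leibniz_cyclic:
  fixes b :: "'e \<Rightarrow> 'r :: comm_ring_1" and d :: "'v \<Rightarrow> 'r"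
  shows "set_det (verts G) (\<lambda>u v. (if u = v then d u else 0) - (\<Sum>e | e \<in> arcs G \<and> tail G e = u \<and> head G e = v. b e))
   = (\<Sum>S | cyclic S. of_int (sign (next_vertex S)) * ((\<Prod>e\<in>S. - b e) * (\<Prod>v\<in>verts G - tail G ` S. d v)))"
proof -
  define E where "E u v = {e \<in> arcs G. tail G e = u \<and> head G e = v}" for u v
  \<comment> \<open>The choices in row \<open>u\<close> and column \<open>v\<close>: \<open>None\<close> stands for the diagonal term.\<close>
  define B where "B u v = (if u = v then {None} else {}) \<union> Some ` E u v" for u v
  define t where "t u x = (case x of None \<Rightarrow> d u | Some e \<Rightarrow> - b e)" for u :: 'v and x
  have finE: "finite (E u v)" for u v by (simp add: E_def)
  have finB: "finite (B u v)" for u v by (simp add: B_def finE)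
  have a: "(if u = v then d u else 0) - (\<Sum>e | e \<in> arcs G \<and> tail G e = u \<and> head G e = v. b e)
    = (\<Sum>x\<in>B u v. t u x)" for u v
  proof -
    have "(\<Sum>x\<in>B u v. t u x) = (\<Sum>x\<in>(if u = v then {None} else {}). t u x) + (\<Sum>x\<in>Some ` E u v. t u x)"
      unfolding B_def by (rule sum.union_disjoint) (auto simp: finE)
    also have "(\<Sum>x\<in>Some ` E u v. t u x) = - (\<Sum>e\<in>E u v. b e)"
      by (subst sum.reindex) (auto simp: t_def sum_negf)
    finally show ?thesis by (simp add: t_def E_def)
  qed
  have "set_det (verts G) (\<lambda>u v. \<Sum>x\<in>B u v. t u x) =
    (\<Sum>\<sigma> | \<sigma> permutes verts G. \<Sum>g\<in>PiE (verts G) (\<lambda>v. B v (\<sigma> v)). of_int (sign \<sigma>) * (\<Prod>v\<in>verts G. t v (g v)))"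
    unfolding set_det_def by (simp add: prod_sum_PiE finB sum_distrib_left)
  also have "\<dots> = (\<Sum>(\<sigma>, g)\<in>Sigma {\<sigma>. \<sigma> permutes verts G} (\<lambda>\<sigma>. PiE (verts G) (\<lambda>v. B v (\<sigma> v))).
      of_int (sign \<sigma>) * (\<Prod>v\<in>verts G. t v (g v)))"
    by (rule sum.Sigma) (auto simp: finite_permutations finite_PiE finB)
  also have "\<dots> = (\<Sum>S | cyclic S. of_int (sign (next_vertex S)) * (\<Prod>v\<in>verts G. t v (out_arc S v)))"
  proof (rule sum.reindex_bij_witness[where
        i = "\<lambda>S. (next_vertex S, restrict (out_arc S) (verts G))" and
        j = "\<lambda>(\<sigma>, g). {e. \<exists>v\<in>verts G. g v = Some e}"])
    fix S assume "S \<in> {S. cyclic S}"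
    then have S: "cyclic S" by simp
    have SV: "tail G e \<in> verts G" "head G e \<in> verts G" "e \<in> arcs G" if "e \<in> S" for e
      using S that by (auto simp: cyclic_def)
    show "(next_vertex S, restrict (out_arc S) (verts G)) \<in> Sigma {\<sigma>. \<sigma> permutes verts G} (\<lambda>\<sigma>. PiE (verts G) (\<lambda>v. B v (\<sigma> v)))"
    proof -
      have "out_arc S v \<in> B v (next_vertex S v)" if "v \<in> verts G" for v
      proof (cases "out_arc S v")
        case None
        then show ?thesis by (simp add: B_def next_vertex_def)
      next
        case (Some e)
        then have e: "e \<in> S" "tail G e = v" using out_arc_eq_Some[OF S] by auto
        then show ?thesis using SV(3)[OF e(1)] by (simp add: Some B_def E_def next_vertex_def)
      qed
      then show ?thesis using next_vertex_permutes[OF S] by auto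
    qed
    show "(case (next_vertex S, restrict (out_arc S) (verts G)) of (\<sigma>, g) \<Rightarrow> {e. \<exists>v\<in>verts G. g v = Some e}) = S"
      by (auto simp: out_arc_eq_Some[OF S] intro: SV)
  next
    fix x assume "x \<in> Sigma {\<sigma>. \<sigma> permutes verts G} (\<lambda>\<sigma>. PiE (verts G) (\<lambda>v. B v (\<sigma> v)))"
    then obtain \<sigma> g where x: "x = (\<sigma>, g)" and \<sigma>: "\<sigma> permutes verts G"
      and g: "g \<in> PiE (verts G) (\<lambda>v. B v (\<sigma> v))" by auto
    define S where "S = {e. \<exists>v\<in>verts G. g v = Some e}"
    have gB: "g v \<in> B v (\<sigma> v)" if "v \<in> verts G" for v using PiE_mem[OF g that] .
    have gS: "e \<in> arcs G" "tail G e = v" "head G e = \<sigma> v" if "v \<in> verts G" "g v = Some e" for v e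
      using gB[OF that(1)] that(2) by (auto simp: B_def E_def split: if_splits)
    have gN: "\<sigma> v = v" if "v \<in> verts G" "g v = None" for v
      using gB[OF that(1)] that(2) by (auto simp: B_def split: if_splits)
    have S1: "e \<in> arcs G" "g (tail G e) = Some e" "head G e = \<sigma> (tail G e)" if "e \<in> S" for e
      using that gS by (auto simp: S_def)
    have tS: "v \<in> tail G ` S \<longleftrightarrow> g v \<noteq> None" if "v \<in> verts G" for v
    proof
      show "v \<in> tail G ` S \<Longrightarrow> g v \<noteq> None" using S1(2) by force
      assume "g v \<noteq> None"
      then obtain e where "g v = Some e" by auto
      with that gS show "v \<in> tail G ` S" by (auto simp: S_def image_iff intro!: exI[of _ e])
    qed
    have it: "inj_on (tail G) S" by (rule inj_onI) (metis S1(2) option.inject)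
    have ih: "inj_on (head G) S"
    proof (rule inj_onI)
      fix e e' assume "e \<in> S" "e' \<in> S" "head G e = head G e'"
      then have "tail G e = tail G e'" using S1(3) permutes_inj[OF \<sigma>] by (metis injD)
      then show "e = e'" using it \<open>e \<in> S\<close> \<open>e' \<in> S\<close> by (auto dest: inj_onD)
    qed
    have finS: "finite S" using S1(1) by (auto intro: finite_subset[of _ "arcs G"])
    have "tail G ` S \<subseteq> head G ` S"
    proof
      fix v assume v: "v \<in> tail G ` S"
      then have vV: "v \<in> verts G" using S1(1) by auto
      obtain u where "\<sigma> u = v" using permutes_surj[OF \<sigma>] by (metis surjD)
      then have u: "u \<in> verts G" "\<sigma> u = v" using vV permutes_in_image[OF \<sigma>, of u] by auto
      show "v \<in> head G ` S"
      proof (cases "g u")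
        case None
        then have "u = v" using gN u by auto
        then show ?thesis using None tS[OF vV] v by simp
      next
        case (Some e)
        then have "e \<in> S" using u by (auto simp: S_def)
        then show ?thesis using gS(3)[OF u(1) Some] u by auto
      qed
    qed
    then have "tail G ` S = head G ` S"
      by (intro card_subset_eq finite_imageI finS) (simp_all add: card_image it ih)
    then have cyc: "cyclic S" using S1(1) it ih by (auto simp: cyclic_def)
    have og: "out_arc S v = g v" if "v \<in> verts G" for v
    proof (cases "g v")
      case None then show ?thesis using tS[OF that] by (simp add: out_arc_eq_None)
    next
      case (Some e)
      then show ?thesis using that gS[OF that Some] out_arc_eq_Some[OF cyc] by (auto simp: S_def)
    qed
    have st: "next_vertex S = \<sigma>"
    proof
      fix v
      show "next_vertex S v = \<sigma> v"
      proof (cases "v \<in> verts G")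
        case True
        then show ?thesis using gN[OF True] gS(3)[OF True] by (auto simp: next_vertex_def og split: option.split)
      next
        case False
        then show ?thesis using permutes_not_in[OF \<sigma> False] permutes_not_in[OF next_vertex_permutes[OF cyc] False] by simp
      qed
    qed
    have gr: "restrict (out_arc S) (verts G) = g"
      using og g by (auto simp: fun_eq_iff PiE_def extensional_def)
    show "(case x of (\<sigma>, g) \<Rightarrow> {e. \<exists>v\<in>verts G. g v = Some e}) \<in> {S. cyclic S}"
      using cyc by (simp add: x S_def)
    show "(next_vertex (case x of (\<sigma>, g) \<Rightarrow> {e. \<exists>v\<in>verts G. g v = Some e}),
        restrict (out_arc (case x of (\<sigma>, g) \<Rightarrow> {e. \<exists>v\<in>verts G. g v = Some e})) (verts G)) = x"
      using st gr by (simp add: x S_def)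
    show "of_int (sign (next_vertex (case x of (\<sigma>, g) \<Rightarrow> {e. \<exists>v\<in>verts G. g v = Some e}))) *
        (\<Prod>v\<in>verts G. t v (out_arc (case x of (\<sigma>, g) \<Rightarrow> {e. \<exists>v\<in>verts G. g v = Some e}) v)) =
      (case x of (\<sigma>, g) \<Rightarrow> of_int (sign \<sigma>) * (\<Prod>v\<in>verts G. t v (g v)))"
      using st og by (simp add: x S_def[symmetric])
  qed
  also have "\<dots> = (\<Sum>S | cyclic S. of_int (sign (next_vertex S)) * ((\<Prod>e\<in>S. - b e) * (\<Prod>v\<in>verts G - tail G ` S. d v)))"
  proof (intro sum.cong refl arg_cong[of _ _ "(*) _"])
    fix S assume "S \<in> {S. cyclic S}"
    then have S: "cyclic S" by simp
    then have sub: "tail G ` S \<subseteq> verts G" using cyclicD(1)[OF S] by auto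
    have "(\<Prod>v\<in>verts G. t v (out_arc S v)) =
      (\<Prod>v\<in>verts G - tail G ` S. t v (out_arc S v)) * (\<Prod>v\<in>tail G ` S. t v (out_arc S v))"
      by (rule prod.subset_diff[OF sub]) simp
    also have "(\<Prod>v\<in>tail G ` S. t v (out_arc S v)) = (\<Prod>e\<in>S. - b e)"
      by (subst prod.reindex) (auto simp: cyclicD(2)[OF S] out_arc_tail[OF S] t_def intro!: prod.cong)
    also have "(\<Prod>v\<in>verts G - tail G ` S. t v (out_arc S v)) = (\<Prod>v\<in>verts G - tail G ` S. d v)"
      by (intro prod.cong) (auto simp: t_def out_arc_def)
    finally show "(\<Prod>v\<in>verts G. t v (out_arc S v)) = (\<Prod>e\<in>S. - b e) * (\<Prod>v\<in>verts G - tail G ` S. d v)"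
      by (simp add: mult.commute)
  qed
  finally show ?thesis by (simp add: a)
qed

end


section \<open>Oriented cycles and matchings\<close>

context weighted_graph
begin

text \<open>
  Loops are cycles of length one here, and two parallel edges may form a cycle of length two; only the
  2-cycles that go back along the same edge are excluded.
\<close>

definition oriented :: "'e set \<Rightarrow> bool" where
  "oriented S \<longleftrightarrow> cyclic S \<and> (\<forall>e\<in>S. arev e \<notin> S)"

text \<open>
  A matching is given by both arcs of each of its edges. Injectivity of the tail excludes loops, because
  a loop and its reverse have the same tail.
\<close>

definition matching_off :: "'e set \<Rightarrow> 'e set \<Rightarrow> bool" where
  "matching_off S M \<longleftrightarrow> M \<subseteq> arcs G \<and> inj_on (tail G) M \<and> (\<forall>e\<in>M. arev e \<in> M) \<and> tail G ` M \<inter> tail G ` S = {}"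

lemma matching_image:
  assumes "M \<subseteq> arcs G" "\<forall>e\<in>M. arev e \<in> M"
  shows "arev ` M = M" "head G ` M = tail G ` M"
proof -
  show a: "arev ` M = M"
    using assms(2) by (metis arev_arev image_subset_iff subsetI subset_antisym image_eqI)
  have "head G ` M = head G ` arev ` M" using a by simp
  also have "\<dots> = tail G ` M" using assms(1) by (auto simp: image_image intro!: image_cong)
  finally show "head G ` M = tail G ` M" .
qed

lemma cyclic_union:
  assumes "cyclic S" "matching_off S M"
  shows "cyclic (S \<union> M)" "S \<inter> M = {}"
proof -
  note S = cyclicD[OF assms(1)]
  have M: "M \<subseteq> arcs G" "inj_on (tail G) M" "\<forall>e\<in>M. arev e \<in> M" "tail G ` M \<inter> tail G ` S = {}"
    using assms(2) by (auto simp: matching_off_def)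
  note Mi = matching_image[OF M(1,3)]
  show "S \<inter> M = {}" using M(4) by auto
  have ih: "inj_on (head G) M"
  proof (rule inj_onI)
    fix e e' assume e: "e \<in> M" "e' \<in> M" "head G e = head G e'"
    then have "tail G (arev e) = tail G (arev e')" using M(1) by (simp add: subset_iff)
    then have "arev e = arev e'" using inj_onD[OF M(2)] M(3) e(1,2) by blast
    then show "e = e'" by (metis arev_arev)
  qed
  have "tail G ` (S - M) \<inter> tail G ` (M - S) = {}" "head G ` (S - M) \<inter> head G ` (M - S) = {}"
    using M(4) Mi(2) S(4) by blast+
  then have "inj_on (tail G) (S \<union> M)" "inj_on (head G) (S \<union> M)"
    using S(2,3) M(2) ih by (simp_all add: inj_on_Un)
  then show "cyclic (S \<union> M)" using S M Mi by (auto simp: cyclic_def image_Un)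
qed

lemma no_loop_in_matching:
  assumes "M \<subseteq> arcs G" "inj_on (tail G) M" "\<forall>e\<in>M. arev e \<in> M" "e \<in> M"
  shows "tail G e \<noteq> head G e"
proof
  assume "tail G e = head G e"
  then have "tail G (arev e) = tail G e" using assms(1,4) by (simp add: subset_iff)
  then have "arev e = e" using inj_onD[OF assms(2)] assms(3,4) by blast
  then show False using assms(1,4) arev_neq by auto
qed

text \<open>
  Each matched edge adds two arcs and a transposition of two vertices that were fixed before.
\<close>

lemma sign_next_vertex_union:
  assumes "cyclic S" "matching_off S M"
  shows "even (card M) \<and> sign (next_vertex (S \<union> M)) = sign (next_vertex S) * (- 1) ^ (card M div 2)"
  using assms(2)
proof (induction "card M" arbitrary: M rule: less_induct)
  case less
  have M: "M \<subseteq> arcs G" "inj_on (tail G) M" "\<forall>e\<in>M. arev e \<in> M" "tail G ` M \<inter> tail G ` S = {}"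
    using less.prems by (auto simp: matching_off_def)
  have finM: "finite M" using M(1) by (rule finite_subset) simp
  show ?case
  proof (cases "M = {}")
    case True
    then show ?thesis by simp
  next
    case False
    then obtain e where e: "e \<in> M" by auto
    define N where "N = M - {e, arev e}"
    have ae: "arev e \<in> M" "arev e \<noteq> e" "e \<in> arcs G" using e M arev_neq by auto
    have th: "tail G e \<noteq> head G e" by (rule no_loop_in_matching[OF M(1-3) e])
    have cM: "card M = card N + 2"
      using finM e ae card_Diff_subset[of "{e, arev e}" M] card_mono[of M "{e, arev e}"] by (auto simp: N_def)
    have N: "matching_off S N"
      unfolding matching_off_def
    proof (intro conjI ballI)
      show "inj_on (tail G) N" using M(2) by (rule inj_on_subset) (auto simp: N_def)
      fix x assume "x \<in> N"
      then show "arev x \<in> N" using M(3) by (auto simp: N_def) (metis arev_arev)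
    qed (use M in \<open>auto simp: N_def\<close>)
    have IH: "even (card N)" "sign (next_vertex (S \<union> N)) = sign (next_vertex S) * (- 1) ^ (card N div 2)"
      using less.hyps[OF _ N] cM by auto
    have cN: "cyclic (S \<union> N)" and cM': "cyclic (S \<union> M)"
      using cyclic_union[OF assms(1)] N less.prems by auto
    have out: "tail G e \<notin> tail G ` (S \<union> N)" "head G e \<notin> tail G ` (S \<union> N)"
    proof -
      have "tail G e \<notin> tail G ` N" using M(2) e by (auto simp: N_def inj_on_def)
      moreover have "tail G (arev e) \<notin> tail G ` N" using M(2) ae by (auto simp: N_def inj_on_def)
      ultimately show "tail G e \<notin> tail G ` (S \<union> N)" "head G e \<notin> tail G ` (S \<union> N)"
        using M(4) e ae image_eqI[of "head G e" "tail G" "arev e" M] by auto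
    qed
    have "next_vertex (S \<union> M) = transpose (tail G e) (head G e) \<circ> next_vertex (S \<union> N)"
    proof
      fix v
      show "next_vertex (S \<union> M) v = (transpose (tail G e) (head G e) \<circ> next_vertex (S \<union> N)) v"
      proof (cases "v \<in> tail G ` (S \<union> N)")
        case True
        then obtain x where x: "x \<in> S \<union> N" "v = tail G x" by auto
        then have "x \<in> S \<union> M" by (auto simp: N_def)
        have "head G x \<in> tail G ` (S \<union> N)" unfolding cyclicD(4)[OF cN] using x(1) by (rule imageI)
        then have "head G x \<noteq> tail G e" "head G x \<noteq> head G e" using out by auto
        then show ?thesis
          using next_vertex_tail[OF cN x(1)] next_vertex_tail[OF cM' \<open>x \<in> S \<union> M\<close>] x(2) by simp
      next
        case False
        then have fx: "next_vertex (S \<union> N) v = v" by (rule next_vertex_fixed)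
        consider "v = tail G e" | "v = head G e" | "v \<noteq> tail G e" "v \<noteq> head G e" by auto
        then show ?thesis
        proof cases
          case 1
          then show ?thesis using fx next_vertex_tail[OF cM', of e] e by simp
        next
          case 2
          then show ?thesis using fx next_vertex_tail[OF cM', of "arev e"] ae by simp
        next
          case 3
          have "S \<union> M = (S \<union> N) \<union> {e, arev e}" using e ae by (auto simp: N_def)
          then have "v \<notin> tail G ` (S \<union> M)" using False 3 ae by auto
          then show ?thesis using fx 3 by (simp add: next_vertex_fixed)
        qed
      qed
    qed
    then have "sign (next_vertex (S \<union> M)) = sign (transpose (tail G e) (head G e)) * sign (next_vertex (S \<union> N))"
      using permutation_permutes[THEN iffD2, OF exI, OF conjI, OF finite_verts next_vertex_permutes[OF cN]]
      by (simp add: sign_compose permutation_swap_id)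
    also have "\<dots> = - sign (next_vertex (S \<union> N))" using th by (simp add: sign_swap_id)
    finally show ?thesis using IH cM by simp
  qed
qed

text \<open>
  The matching consists of the arcs whose reverse is also present. It shares no vertex with the
  remaining arcs, since at most one arc leaves each vertex.
\<close>

lemma sum_cyclic_decomposition:
  fixes \<phi> :: "'e set \<Rightarrow> 'r :: comm_ring_1"
  shows "(\<Sum>S | cyclic S. \<phi> S) = (\<Sum>S | oriented S. \<Sum>M | matching_off S M. \<phi> (S \<union> M))"
proof -
  have fin: "finite {S. oriented S}" "finite {M. matching_off S M}" for S
    by (rule finite_subset[of _ "Pow (arcs G)"]; auto simp: oriented_def cyclic_def matching_off_def)+
  have "(\<Sum>S | oriented S. \<Sum>M | matching_off S M. \<phi> (S \<union> M)) =
    (\<Sum>(S, M)\<in>Sigma {S. oriented S} (\<lambda>S. {M. matching_off S M}). \<phi> (S \<union> M))"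
    by (rule sum.Sigma) (use fin in auto)
  also have "\<dots> = (\<Sum>S | cyclic S. \<phi> S)"
  proof (rule sum.reindex_bij_witness[where j = "\<lambda>(S, M). S \<union> M" and
        i = "\<lambda>S. ({e\<in>S. arev e \<notin> S}, {e\<in>S. arev e \<in> S})"])
    fix S assume "S \<in> {S. cyclic S}"
    then have S: "cyclic S" by simp
    define A where "A = {e\<in>S. arev e \<notin> S}"
    define M where "M = {e\<in>S. arev e \<in> S}"
    have S_eq: "S = A \<union> M" by (auto simp: A_def M_def)
    have M: "M \<subseteq> arcs G" "\<forall>e\<in>M. arev e \<in> M" using cyclicD(1)[OF S] by (auto simp: M_def)
    have inj: "inj_on (tail G) (A \<union> M)" "inj_on (head G) (A \<union> M)"
      and im: "tail G ` (A \<union> M) = head G ` (A \<union> M)"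
      using cyclicD(2-4)[OF S] unfolding S_eq by simp_all
    have AM: "A - M = A" "M - A = M" by (auto simp: A_def M_def)
    have dis: "tail G ` A \<inter> tail G ` M = {}" "head G ` A \<inter> head G ` M = {}"
      using inj unfolding inj_on_Un AM by simp_all
    have mo: "matching_off A M"
      using M inj(1) dis(1) by (auto simp: matching_off_def inj_on_Un)
    have "tail G ` A = tail G ` (A \<union> M) - tail G ` M" "head G ` A = head G ` (A \<union> M) - head G ` M"
      using dis by blast+
    then have "tail G ` A = head G ` A" using matching_image(2)[OF M] im by simp
    then have "cyclic A"
      using cyclicD(1)[OF S] inj by (auto simp: cyclic_def inj_on_Un A_def)
    then have "oriented A" by (auto simp: oriented_def A_def)
    with mo show "({e\<in>S. arev e \<notin> S}, {e\<in>S. arev e \<in> S}) \<in> Sigma {S. oriented S} (\<lambda>S. {M. matching_off S M})"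
      by (simp add: A_def M_def)
    show "(case ({e\<in>S. arev e \<notin> S}, {e\<in>S. arev e \<in> S}) of (S, M) \<Rightarrow> S \<union> M) = S" by auto
  next
    fix x assume "x \<in> Sigma {S. oriented S} (\<lambda>S. {M. matching_off S M})"
    then obtain S M where x: "x = (S, M)" and S: "oriented S" and M: "matching_off S M" by auto
    have cS: "cyclic S" using S by (simp add: oriented_def)
    show "(case x of (S, M) \<Rightarrow> S \<union> M) \<in> {S. cyclic S}" using cyclic_union[OF cS M] by (simp add: x)
    have dis: "S \<inter> M = {}" by (rule cyclic_union(2)[OF cS M])
    have aM: "arev e \<in> M \<longleftrightarrow> e \<in> M" for e using M unfolding matching_off_def by (metis arev_arev)
    have aS: "arev e \<notin> S" if "e \<in> S" for e using S that by (simp add: oriented_def)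
    have "{e\<in>S \<union> M. arev e \<notin> S \<union> M} = S" "{e\<in>S \<union> M. arev e \<in> S \<union> M} = M"
      using dis aM aS by auto
    then show "({e\<in>case x of (S, M) \<Rightarrow> S \<union> M. arev e \<notin> (case x of (S, M) \<Rightarrow> S \<union> M)},
        {e\<in>case x of (S, M) \<Rightarrow> S \<union> M. arev e \<in> (case x of (S, M) \<Rightarrow> S \<union> M)}) = x"
      by (simp add: x)
    show "\<phi> (case x of (S, M) \<Rightarrow> S \<union> M) = (case x of (S, M) \<Rightarrow> \<phi> (S \<union> M))" by (simp add: x)
  qed
  finally show ?thesis by simp
qed

text \<open>
  The value at \<open>l\<close> of the matching polynomial of the graph without the vertices of \<open>S\<close>
  (\<open>poly_matching_poly_delete\<close>).
\<close>

definition matching_sum :: "'e set \<Rightarrow> complex" where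
  "matching_sum S = (\<Sum>M | matching_off S M. (- 1) ^ (card M div 2) * (\<Prod>e\<in>M. w e) *
     (\<Prod>v\<in>verts G - tail G ` S - tail G ` M. complex_of_real (l - pot v)))"

text \<open>
  Reversal permutes the arcs and changes the sign of the sum, and the group of chains has no 2-torsion.
\<close>

lemma sum_arc_chain_matching:
  assumes "M \<subseteq> arcs G" "\<forall>e\<in>M. arev e \<in> M"
  shows "(\<Sum>e\<in>M. arc_chain e) = 0"
proof -
  have "(\<Sum>e\<in>M. arc_chain e) = (\<Sum>e\<in>arev ` M. arc_chain e)" by (simp add: matching_image[OF assms])
  also have "\<dots> = (\<Sum>e\<in>M. arc_chain (arev e))"
    by (subst sum.reindex) (auto intro: inj_onI dest: arg_cong[of _ _ arev])
  also have "\<dots> = - (\<Sum>e\<in>M. arc_chain e)" by (simp add: arc_chain_arev sum_negf)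
  finally show ?thesis by (metis neg_equal_zero)
qed

lemma prod_single:
  "finite S \<Longrightarrow> (\<Prod>e\<in>S. Poly_Mapping.single (k e) (c e)) =
    Poly_Mapping.single (\<Sum>e\<in>S. k e :: chain) (\<Prod>e\<in>S. c e :: complex)"
  by (induction S rule: finite_induct) (simp_all add: mult_single)

lemma single_sum:
  "Poly_Mapping.single (k :: chain) (\<Sum>a\<in>A. c a :: complex) = (\<Sum>a\<in>A. Poly_Mapping.single k (c a))"
  by (induction A rule: infinite_finite_induct) (simp_all add: single_add)

text \<open>
  In the contribution of \<open>S \<union> M\<close> the monomials of \<open>M\<close> cancel and the signs of its arcs come in pairs, so the
  contributions for a fixed \<open>S\<close> add up to a single monomial.
\<close>

lemma det_twisted:
  "set_det (verts G) twisted =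
    (\<Sum>S | oriented S. Poly_Mapping.single (\<Sum>e\<in>S. arc_chain e)
        (of_int (sign (next_vertex S)) * (\<Prod>e\<in>S. - w e) * matching_sum S))"
proof -
  have "set_det (verts G) twisted =
    (\<Sum>S | cyclic S. of_int (sign (next_vertex S)) * ((\<Prod>e\<in>S. - Poly_Mapping.single (arc_chain e) (w e)) *
       (\<Prod>v\<in>verts G - tail G ` S. Poly_Mapping.single 0 (complex_of_real (l - pot v)))))"
    unfolding twisted_def[abs_def] by (rule Leibniz_cyclic)
  also have "\<dots> = (\<Sum>S | cyclic S. Poly_Mapping.single (\<Sum>e\<in>S. arc_chain e)
      (of_int (sign (next_vertex S)) * ((\<Prod>e\<in>S. - w e) * (\<Prod>v\<in>verts G - tail G ` S. complex_of_real (l - pot v)))))"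
  proof (intro sum.cong refl)
    fix S assume "S \<in> {S. cyclic S}"
    then have "finite S" by (simp add: cyclicD)
    then show "of_int (sign (next_vertex S)) * ((\<Prod>e\<in>S. - Poly_Mapping.single (arc_chain e) (w e)) *
       (\<Prod>v\<in>verts G - tail G ` S. Poly_Mapping.single 0 (complex_of_real (l - pot v)))) =
      Poly_Mapping.single (\<Sum>e\<in>S. arc_chain e)
      (of_int (sign (next_vertex S)) * ((\<Prod>e\<in>S. - w e) * (\<Prod>v\<in>verts G - tail G ` S. complex_of_real (l - pot v))))"
      by (simp add: prod_single mult_single flip: single_uminus single_of_int)
  qed
  also have "\<dots> = (\<Sum>S | oriented S. \<Sum>M | matching_off S M.
     Poly_Mapping.single (\<Sum>e\<in>S \<union> M. arc_chain e)
      (of_int (sign (next_vertex (S \<union> M))) * ((\<Prod>e\<in>S \<union> M. - w e) *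
        (\<Prod>v\<in>verts G - tail G ` (S \<union> M). complex_of_real (l - pot v)))))"
    by (rule sum_cyclic_decomposition)
  also have "\<dots> = (\<Sum>S | oriented S. \<Sum>M | matching_off S M. Poly_Mapping.single (\<Sum>e\<in>S. arc_chain e)
     (of_int (sign (next_vertex S)) * (\<Prod>e\<in>S. - w e) * ((- 1) ^ (card M div 2) * (\<Prod>e\<in>M. w e) *
     (\<Prod>v\<in>verts G - tail G ` S - tail G ` M. complex_of_real (l - pot v)))))"
  proof (intro sum.cong refl, clarify)
    fix S M assume "oriented S" and M: "matching_off S M"
    then have S: "cyclic S" by (simp add: oriented_def)
    have M': "M \<subseteq> arcs G" "\<forall>e\<in>M. arev e \<in> M" using M by (auto simp: matching_off_def)
    have fin: "finite S" "finite M" "S \<inter> M = {}"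
      using cyclicD(5)[OF S] cyclic_union(2)[OF S M] finite_subset[OF M'(1)] by auto
    have "(\<Sum>e\<in>S \<union> M. arc_chain e) = (\<Sum>e\<in>S. arc_chain e)"
      using sum.union_disjoint[OF fin, of arc_chain] sum_arc_chain_matching[OF M'] by simp
    moreover have "(\<Prod>e\<in>S \<union> M. - w e) = (\<Prod>e\<in>S. - w e) * (\<Prod>e\<in>M. w e)"
    proof -
      have "(\<Prod>e\<in>M. - w e) = (\<Prod>e\<in>M. w e)"
        using sign_next_vertex_union[OF S M] prod.distrib[of "\<lambda>_. - 1" w M] by simp
      then show ?thesis using prod.union_disjoint[OF fin, of "\<lambda>e. - w e"] by simp
    qed
    moreover have "verts G - tail G ` (S \<union> M) = verts G - tail G ` S - tail G ` M" by auto
    ultimately show "Poly_Mapping.single (\<Sum>e\<in>S \<union> M. arc_chain e)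
      (of_int (sign (next_vertex (S \<union> M))) * ((\<Prod>e\<in>S \<union> M. - w e) *
        (\<Prod>v\<in>verts G - tail G ` (S \<union> M). complex_of_real (l - pot v)))) = Poly_Mapping.single (\<Sum>e\<in>S. arc_chain e)
     (of_int (sign (next_vertex S)) * (\<Prod>e\<in>S. - w e) * ((- 1) ^ (card M div 2) * (\<Prod>e\<in>M. w e) *
     (\<Prod>v\<in>verts G - tail G ` S - tail G ` M. complex_of_real (l - pot v))))"
      using sign_next_vertex_union[OF S M] by (simp add: mult_ac)
  qed
  also have "\<dots> = (\<Sum>S | oriented S. Poly_Mapping.single (\<Sum>e\<in>S. arc_chain e)
        (of_int (sign (next_vertex S)) * (\<Prod>e\<in>S. - w e) * matching_sum S))"
    unfolding matching_sum_def sum_distrib_left single_sum ..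
  finally show ?thesis .
qed

lemma lookup_sum_arc_chain:
  assumes "S \<subseteq> arcs G" "e \<in> arcs G"
  shows "Poly_Mapping.lookup (\<Sum>x\<in>S. arc_chain x) (\<nu> e) = (if e \<in> S then 1 else 0) - (if arev e \<in> S then 1 else 0)"
proof -
  have fin: "finite S" using assms(1) by (rule finite_subset) simp
  have k: "Poly_Mapping.lookup (arc_chain x) (\<nu> e) = (if x = e then 1 else 0) - (if x = arev e then 1 else 0)"
    if "x \<in> S" for x
    by (rule lookup_arc_chain) (use that assms in auto)
  show ?thesis by (simp add: lookup_sum k sum_subtractf fin)
qed

text \<open>
  The coefficient of the total chain at the coordinate of \<open>e\<close> is 1 if \<open>e\<close> lies in the set, -1 if its
  reverse does, and 0 otherwise; the first two cases exclude each other.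
\<close>

lemma oriented_determined_by_chain:
  assumes "oriented S" "oriented T" "(\<Sum>e\<in>S. arc_chain e) = (\<Sum>e\<in>T. arc_chain e)"
  shows "S = T"
proof -
  have mem: "e \<in> S \<longleftrightarrow> e \<in> arcs G \<and> Poly_Mapping.lookup (\<Sum>x\<in>S. arc_chain x) (\<nu> e) = 1" if "oriented S" for S e
    using that lookup_sum_arc_chain[of S e] by (auto simp: oriented_def cyclic_def split: if_splits)
  show ?thesis
  proof (rule Set.set_eqI)
    fix e
    have "e \<in> S \<longleftrightarrow> e \<in> arcs G \<and> Poly_Mapping.lookup (\<Sum>x\<in>S. arc_chain x) (\<nu> e) = 1"
      by (rule mem[OF assms(1)])
    also have "\<dots> \<longleftrightarrow> e \<in> T"
      unfolding assms(3) by (rule mem[OF assms(2), symmetric])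
    finally show "e \<in> S \<longleftrightarrow> e \<in> T" .
  qed
qed

lemma det_twisted_eq_0_iff:
  "set_det (verts G) twisted = 0 \<longleftrightarrow> (\<forall>S. oriented S \<longrightarrow> matching_sum S = 0)"
proof
  assume det: "set_det (verts G) twisted = 0"
  show "\<forall>S. oriented S \<longrightarrow> matching_sum S = 0"
  proof (intro allI impI)
    fix S assume S: "oriented S"
    define c where "c S = of_int (sign (next_vertex S)) * (\<Prod>e\<in>S. - w e) * matching_sum S" for S
    have fin: "finite {S. oriented S}"
      by (rule finite_subset[of _ "Pow (arcs G)"]) (auto simp: oriented_def cyclic_def)
    have "0 = Poly_Mapping.lookup (set_det (verts G) twisted) (\<Sum>e\<in>S. arc_chain e)" by (simp add: det)
    also have "\<dots> = (\<Sum>T | oriented T. if T = S then c T else 0)"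
      unfolding det_twisted lookup_sum
      by (intro sum.cong refl)
        (use oriented_determined_by_chain[OF _ S] in \<open>auto simp: lookup_single when_def c_def\<close>)
    also have "\<dots> = c S" using fin S by simp
    finally have "of_int (sign (next_vertex S)) * (\<Prod>e\<in>S. - w e) * matching_sum S = 0" by (simp add: c_def)
    moreover have "(\<Prod>e\<in>S. - w e) \<noteq> 0"
      using S w_nz by (auto simp: oriented_def prod_zero_iff cyclicD dest: cyclicD(1))
    moreover have "of_int (sign (next_vertex S)) \<noteq> (0::complex)" by (simp add: sign_def)
    ultimately show "matching_sum S = 0" by simp
  qed
qed (simp add: det_twisted)

end


section \<open>Degree-2 subgraphs and matching polynomials\<close>

context weighted_graph
begin

definition arc_graph :: "'e set \<Rightarrow> ('v, 'e) pre_digraph" where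
  "arc_graph A = \<lparr> verts = tail G ` A, arcs = A, tail = tail G, head = head G \<rparr>"

lemma subgraph_arc_graph:
  assumes "wf_digraph G'" "tail G' = tail G" "head G' = head G" "A \<subseteq> arcs G'" "head G ` A \<subseteq> tail G ` A"
  shows "subgraph (arc_graph A) G'"
proof -
  interpret G': wf_digraph G' by fact
  have "tail G e \<in> verts G'" if "e \<in> A" for e
    using G'.tail_in_verts[of e] assms(2,4) that by auto
  moreover have "wf_digraph (arc_graph A)"
    by unfold_locales (use assms(5) in \<open>auto simp: arc_graph_def\<close>)
  ultimately show ?thesis
    using assms by (auto simp: subgraph_def arc_graph_def compatible_def)
qed

text \<open>
  As the degree is positive there are no isolated vertices, so the subgraph is determined by its arcs.
\<close>

lemma degree_subgraph_arcs:
  assumes "degree_subgraph n G' arev H" "n > 0" "tail G' = tail G" "head G' = head G"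
  shows "tail H = tail G" "head H = head G" "arcs H \<subseteq> arcs G'" "verts H \<subseteq> verts G'"
    "\<And>e. e \<in> arcs H \<Longrightarrow> arev e \<in> arcs H"
    "\<And>e. e \<in> arcs H \<Longrightarrow> tail G e \<in> verts H \<and> head G e \<in> verts H"
    "\<And>v. v \<in> verts H \<Longrightarrow> card {e\<in>arcs H. tail G e = v} = n"
    "verts H = tail G ` arcs H"
proof -
  have sub: "subgraph H G'" and ar: "\<And>e. e \<in> arcs H \<Longrightarrow> arev e \<in> arcs H"
    and deg: "\<And>v. v \<in> verts H \<Longrightarrow> out_degree H v = n"
    using assms(1) by (auto simp: degree_subgraph_def)
  show t: "tail H = tail G" and h: "head H = head G" and "arcs H \<subseteq> arcs G'" "verts H \<subseteq> verts G'"
    using sub assms(3,4) by (auto simp: subgraph_def compatible_def)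
  interpret H: wf_digraph H using sub by (simp add: subgraph_def)
  show "arev e \<in> arcs H" if "e \<in> arcs H" for e by (rule ar[OF that])
  show th: "tail G e \<in> verts H \<and> head G e \<in> verts H" if "e \<in> arcs H" for e
    using H.tail_in_verts[OF that] H.head_in_verts[OF that] by (simp add: t h)
  show c: "card {e\<in>arcs H. tail G e = v} = n" if "v \<in> verts H" for v
    using deg[OF that] by (simp add: out_degree_def out_arcs_def t)
  show "verts H = tail G ` arcs H"
  proof
    show "verts H \<subseteq> tail G ` arcs H"
    proof
      fix v assume "v \<in> verts H"
      then have "{e\<in>arcs H. tail G e = v} \<noteq> {}" using c assms(2) by (metis card.empty less_numeral_extra(3))
      then show "v \<in> tail G ` arcs H" by auto
    qed
    show "tail G ` arcs H \<subseteq> verts H" using th by auto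
  qed
qed

lemma poly_matching_poly_delete:
  assumes S: "S \<subseteq> arcs G" "verts H = tail G ` S"
  shows "poly (matching_poly (delete_subgraph G H) arev w pot) (complex_of_real l) = matching_sum S"
proof -
  define G' where "G' = delete_subgraph G H"
  have G': "verts G' = verts G - tail G ` S" "tail G' = tail G" "head G' = head G"
    "arcs G' = {e\<in>arcs G. tail G e \<in> verts G - tail G ` S \<and> head G e \<in> verts G - tail G ` S}"
    by (simp_all add: G'_def delete_subgraph_def induce_subgraph_def S)
  have wf: "wf_digraph G'" by unfold_locales (auto simp: G')
  have "poly (matching_poly G' arev w pot) (complex_of_real l) =
    (\<Sum>M\<in>matchings G' arev. (- 1) ^ (card (verts M) div 2) * (\<Prod>e\<in>arcs M. w e) *
       (\<Prod>v\<in>verts G' - verts M. complex_of_real (l - pot v)))"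
    unfolding matching_poly_def poly_sum by (simp add: poly_prod)
  also have "\<dots> = (\<Sum>M | matching_off S M. (- 1) ^ (card M div 2) * (\<Prod>e\<in>M. w e) *
     (\<Prod>v\<in>verts G - tail G ` S - tail G ` M. complex_of_real (l - pot v)))"
  proof (rule sum.reindex_bij_witness[where j = arcs and i = arc_graph])
    fix M assume "M \<in> matchings G' arev"
    then have M: "degree_subgraph 1 G' arev M" by (simp add: matchings_def)
    note D = degree_subgraph_arcs[OF M _ G'(2,3), simplified]
    show "arc_graph (arcs M) = M"
      by (rule pre_digraph.equality) (simp_all add: arc_graph_def D(1,2) D(8)[symmetric])
    have inj: "inj_on (tail G) (arcs M)"
    proof (rule inj_onI)
      fix e e' assume e: "e \<in> arcs M" "e' \<in> arcs M" "tail G e = tail G e'"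
      have "card {x\<in>arcs M. tail G x = tail G e} = 1" using D(7)[of "tail G e"] D(6)[OF e(1)] by simp
      then obtain y where "{x\<in>arcs M. tail G x = tail G e} = {y}" by (rule card_1_singletonE)
      moreover have "e \<in> {x\<in>arcs M. tail G x = tail G e}" "e' \<in> {x\<in>arcs M. tail G x = tail G e}"
        using e by auto
      ultimately show "e = e'" by auto
    qed
    show "arcs M \<in> {M. matching_off S M}"
      using inj D(3,5) by (auto simp: matching_off_def G')
    have "card (verts M) = card (arcs M)" unfolding D(8) by (rule card_image[OF inj])
    then show "(- 1) ^ (card (arcs M) div 2) * (\<Prod>e\<in>arcs M. w e) *
        (\<Prod>v\<in>verts G - tail G ` S - tail G ` arcs M. complex_of_real (l - pot v)) =
      (- 1) ^ (card (verts M) div 2) * (\<Prod>e\<in>arcs M. w e) *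
       (\<Prod>v\<in>verts G' - verts M. complex_of_real (l - pot v))"
      by (simp add: G'(1) D(8))
  next
    fix M assume "M \<in> {M. matching_off S M}"
    then have M: "M \<subseteq> arcs G" "inj_on (tail G) M" "\<forall>e\<in>M. arev e \<in> M" "tail G ` M \<inter> tail G ` S = {}"
      by (auto simp: matching_off_def)
    show "arcs (arc_graph M) = M" by (simp add: arc_graph_def)
    have hd: "head G ` M = tail G ` M" by (rule matching_image(2)[OF M(1,3)])
    have sub: "M \<subseteq> arcs G'"
    proof
      fix e assume e: "e \<in> M"
      then have "e \<in> arcs G" "tail G e \<in> tail G ` M" "head G e \<in> tail G ` M" using M(1) hd by auto
      then show "e \<in> arcs G'" using M(4) by (auto simp: G'(4))
    qed
    have "out_degree (arc_graph M) v = 1" if v: "v \<in> verts (arc_graph M)" for v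
    proof -
      obtain e where e: "e \<in> M" "v = tail G e" using v by (auto simp: arc_graph_def)
      then have "{x\<in>M. tail G x = v} = {e}" using M(2) by (auto dest: inj_onD)
      then show ?thesis by (simp add: out_degree_def out_arcs_def arc_graph_def)
    qed
    moreover have "subgraph (arc_graph M) G'"
      by (rule subgraph_arc_graph[OF wf G'(2,3) sub]) (simp add: hd)
    ultimately show "arc_graph M \<in> matchings G' arev"
      using M(3) by (auto simp: matchings_def degree_subgraph_def arc_graph_def)
  qed
  finally show ?thesis by (simp add: matching_sum_def G'_def)
qed

text \<open>
  Besides the arc of \<open>S\<close> that leaves \<open>v\<close>, the reverse of the arc of \<open>S\<close> that enters \<open>v\<close> leaves \<open>v\<close>. These
  are two different arcs, even if they belong to a loop.
\<close>

lemma degree_2_of_oriented: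
  assumes "oriented S"
  shows "degree_subgraph 2 G arev (arc_graph (S \<union> arev ` S))" "verts (arc_graph (S \<union> arev ` S)) = tail G ` S"
proof -
  have S: "cyclic S" and no: "\<And>e. e \<in> S \<Longrightarrow> arev e \<notin> S" using assms by (auto simp: oriented_def)
  note C = cyclicD[OF S]
  have th: "tail G ` arev ` S = head G ` S" "head G ` arev ` S = tail G ` S"
    using C(1) by (auto simp: image_image subset_iff intro!: image_cong)
  show v: "verts (arc_graph (S \<union> arev ` S)) = tail G ` S"
    by (simp add: arc_graph_def image_Un th C(4))
  have "subgraph (arc_graph (S \<union> arev ` S)) G"
    by (rule subgraph_arc_graph[OF wf_digraph_axioms refl refl]) (use C(1) in \<open>auto simp: image_Un th C(4)\<close>)
  moreover have "out_degree (arc_graph (S \<union> arev ` S)) v = 2" if v': "v \<in> tail G ` S" for v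
  proof -
    obtain e where e: "e \<in> S" "tail G e = v" using v' by auto
    obtain e' where e': "e' \<in> S" "head G e' = v" using v' unfolding C(4) by auto
    have "{x\<in>S \<union> arev ` S. tail G x = v} = {e, arev e'}"
    proof (intro subset_antisym subsetI)
      fix x assume "x \<in> {x\<in>S \<union> arev ` S. tail G x = v}"
      then consider "x \<in> S" "tail G x = v" | y where "y \<in> S" "x = arev y" "tail G (arev y) = v" by auto
      then show "x \<in> {e, arev e'}"
      proof cases
        case 1
        then have "x = e" using inj_onD[OF C(2)] e by auto
        then show ?thesis by simp
      next
        case 2
        then have "head G y = head G e'" using C(1) e' by (simp add: subset_iff)
        then have "y = e'" using inj_onD[OF C(3)] e' 2 by auto
        then show ?thesis using 2 by simp
      qed
    qed (use e e' C(1) in \<open>auto simp: subset_iff\<close>)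
    moreover have "e \<noteq> arev e'" using no e e' by auto
    ultimately show ?thesis by (simp add: out_degree_def out_arcs_def arc_graph_def)
  qed
  ultimately show "degree_subgraph 2 G arev (arc_graph (S \<union> arev ` S))"
    unfolding degree_subgraph_def v by (auto simp: arc_graph_def)
qed

text \<open>
  Let \<open>nxt e\<close> be the arc that continues \<open>e\<close> along its cycle, that is, the arc other than \<open>arev e\<close> that
  leaves the head of \<open>e\<close>. Traversing a cycle never leads from \<open>e\<close> to \<open>arev e\<close>. Hence a maximal set of arcs
  that is closed under \<open>nxt\<close> and contains no arc together with its reverse traverses every cycle in one
  of its two directions.
\<close>

lemma degree_2_has_orientation:
  assumes "degree_subgraph 2 G arev H"
  shows "\<exists>S. oriented S \<and> tail G ` S = verts H"
proof -
  note D = degree_subgraph_arcs[OF assms _ refl refl, simplified]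
  have finH: "finite (arcs H)" using D(3) by (rule finite_subset) simp
  have aG: "e \<in> arcs G" if "e \<in> arcs H" for e using D(3) that by auto
  have two: "\<exists>f. f \<in> arcs H \<and> tail G f = head G e \<and> f \<noteq> arev e \<and>
      (\<forall>g\<in>arcs H. tail G g = head G e \<longrightarrow> g = f \<or> g = arev e)" if e: "e \<in> arcs H" for e
  proof -
    have "card {x\<in>arcs H. tail G x = head G e} = 2" using D(7)[of "head G e"] D(6)[OF e] by simp
    then obtain a b where ab: "{x\<in>arcs H. tail G x = head G e} = {a, b}" "a \<noteq> b"
      by (auto simp: card_2_iff)
    have ae: "arev e \<in> {a, b}" unfolding ab(1)[symmetric] using D(5)[OF e] aG[OF e] by simp
    have mem: "x \<in> arcs H \<and> tail G x = head G e \<longleftrightarrow> x = a \<or> x = b" for x using ab(1) by blast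
    from ae consider "arev e = a" | "arev e = b" by auto
    then show ?thesis
    proof cases
      case 1 then show ?thesis using mem ab(2) by (intro exI[of _ b]) auto
    next
      case 2 then show ?thesis using mem ab(2) by (intro exI[of _ a]) auto
    qed
  qed
  define nxt where "nxt e = (SOME f. f \<in> arcs H \<and> tail G f = head G e \<and> f \<noteq> arev e \<and>
      (\<forall>g\<in>arcs H. tail G g = head G e \<longrightarrow> g = f \<or> g = arev e))" for e
  have nxt: "nxt e \<in> arcs H" "tail G (nxt e) = head G e" "nxt e \<noteq> arev e"
    "\<And>g. g \<in> arcs H \<Longrightarrow> tail G g = head G e \<Longrightarrow> g = nxt e \<or> g = arev e" if "e \<in> arcs H" for e
    using someI_ex[OF two[OF that]] unfolding nxt_def[symmetric] by auto
  \<comment> \<open>Reversal conjugates \<open>nxt\<close> into its inverse.\<close>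
  have nxt_flip: "nxt (arev (nxt e)) = arev e" if e: "e \<in> arcs H" for e
  proof -
    have n: "nxt e \<in> arcs H" "arev (nxt e) \<in> arcs H" by (simp_all add: nxt(1)[OF e] D(5)[OF nxt(1)[OF e]])
    have "arev e = nxt (arev (nxt e)) \<or> arev e = arev (arev (nxt e))"
      by (rule nxt(4)[OF n(2) D(5)[OF e]]) (simp only: tail_arev[OF aG[OF e]] head_arev[OF aG[OF n(1)]] nxt(2)[OF e])
    then show ?thesis using nxt(3)[OF e] by (metis arev_arev)
  qed
  have inj: "inj_on nxt (arcs H)"
  proof (rule inj_onI)
    fix a b assume "a \<in> arcs H" "b \<in> arcs H" "nxt a = nxt b"
    then have "arev a = arev b" using nxt_flip[of a] nxt_flip[of b] by simp
    then show "a = b" by (metis arev_arev)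
  qed
  \<comment> \<open>If \<open>nxt\<close> led from \<open>x\<close> to \<open>arev x\<close> in \<open>n\<close> steps, it would lead from \<open>nxt x\<close> to \<open>arev (nxt x)\<close> in \<open>n - 2\<close> steps; zero steps and one step are impossible.\<close>
  have no_flip: "(nxt ^^ n) x \<noteq> arev x" if "x \<in> arcs H" for n x
    using that
  proof (induction n arbitrary: x rule: less_induct)
    case (less n)
    consider "n = 0" | "n = 1" | m where "n = Suc (Suc m)" by (metis One_nat_def not0_implies_Suc)
    then show ?case
    proof cases
      case 1
      then show ?thesis using arev_neq[OF aG[OF less.prems]] by auto
    next
      case 2
      then show ?thesis using nxt(3)[OF less.prems] by simp
    next
      case 3
      have it: "(nxt ^^ k) y \<in> arcs H" if "y \<in> arcs H" for k y
        using that by (induction k) (auto intro: nxt(1))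
      show ?thesis
      proof
        assume "(nxt ^^ n) x = arev x"
        then have "nxt ((nxt ^^ m) (nxt x)) = nxt (arev (nxt x))"
          using 3 nxt_flip[OF less.prems] by (simp flip: funpow_swap1)
        then have "(nxt ^^ m) (nxt x) = arev (nxt x)"
          using inj_onD[OF inj] it[OF nxt(1)[OF less.prems]] D(5)[OF nxt(1)[OF less.prems]] by blast
        then show False using less.IH[of m "nxt x"] 3 nxt(1)[OF less.prems] by auto
      qed
    qed
  qed
  define good where "good S \<longleftrightarrow> S \<subseteq> arcs H \<and> nxt ` S \<subseteq> S \<and> (\<forall>e\<in>S. arev e \<notin> S)" for S
  have "finite {S. good S}"
    by (rule finite_subset[of _ "Pow (arcs H)"]) (auto simp: good_def finH)
  moreover have "{S. good S} \<noteq> {}" by (auto simp: good_def intro!: exI[of _ "{}"])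
  ultimately obtain S where S: "good S" and max: "\<And>T. good T \<Longrightarrow> S \<subseteq> T \<Longrightarrow> S = T"
    using finite_has_maximal[of "{S. good S}"] by auto
  have SH: "S \<subseteq> arcs H" and Sn: "\<And>e. e \<in> S \<Longrightarrow> nxt e \<in> S" and Sa: "\<And>e. e \<in> S \<Longrightarrow> arev e \<notin> S"
    using S by (auto simp: good_def)
  have injS: "inj_on nxt S" using inj SH by (rule inj_on_subset)
  have surj: "nxt ` S = S"
    using finite_subset[OF SH finH] Sn injS by (intro endo_inj_surj) auto
  have cover: "e \<in> S \<or> arev e \<in> S" if e: "e \<in> arcs H" for e
  proof (rule ccontr)
    assume n: "\<not> (e \<in> S \<or> arev e \<in> S)"
    define Q where "Q = {(nxt ^^ k) e | k. True}"
    have QH: "q \<in> arcs H" if "q \<in> Q" for q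
    proof -
      have "(nxt ^^ k) e \<in> arcs H" for k by (induction k) (auto intro: nxt(1) e)
      then show ?thesis using that by (auto simp: Q_def)
    qed
    have Qn: "nxt q \<in> Q" if "q \<in> Q" for q
      using that by (auto simp: Q_def intro: exI[of _ "Suc _"])
    have QS: "arev ((nxt ^^ k) e) \<notin> S" for k
    proof (induction k)
      case 0 then show ?case using n by simp
    next
      case (Suc k)
      have "(nxt ^^ k) e \<in> arcs H" using QH by (auto simp: Q_def)
      then have "nxt (arev ((nxt ^^ Suc k) e)) = arev ((nxt ^^ k) e)" using nxt_flip by simp
      then show ?case using Sn Suc by metis
    qed
    \<comment> \<open>Steps on the reversed side can be moved to the other side, which leaves \<open>no_flip\<close>.\<close>
    have QQ: "(nxt ^^ i) e \<noteq> arev ((nxt ^^ j) e)" for i j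
    proof (induction j arbitrary: i)
      case 0 then show ?case using no_flip[OF e] by simp
    next
      case (Suc j)
      show ?case
      proof
        assume "(nxt ^^ i) e = arev ((nxt ^^ Suc j) e)"
        moreover have "(nxt ^^ j) e \<in> arcs H" using QH by (auto simp: Q_def)
        ultimately have "(nxt ^^ Suc i) e = arev ((nxt ^^ j) e)" using nxt_flip by simp
        then show False using Suc by blast
      qed
    qed
    have "good (S \<union> Q)"
      unfolding good_def
    proof (intro conjI ballI)
      show "S \<union> Q \<subseteq> arcs H" using SH QH by auto
      show "nxt ` (S \<union> Q) \<subseteq> S \<union> Q" using Sn Qn by auto
      fix x assume x: "x \<in> S \<union> Q"
      have "arev x \<notin> S"
      proof (cases "x \<in> S")
        case False
        then show ?thesis using x QS by (auto simp: Q_def)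
      qed (rule Sa)
      moreover have "arev x \<notin> Q"
      proof
        assume "arev x \<in> Q"
        then obtain k where k: "arev x = (nxt ^^ k) e" by (auto simp: Q_def)
        then have "x = arev ((nxt ^^ k) e)" by (metis arev_arev)
        then have "x \<in> Q" using x QS by auto
        then obtain j where "x = (nxt ^^ j) e" by (auto simp: Q_def)
        then show False using k QQ[of k j] by simp
      qed
      ultimately show "arev x \<notin> S \<union> Q" by simp
    qed
    then have "S = S \<union> Q" by (rule max) simp
    moreover have "e \<in> Q" by (auto simp: Q_def intro: exI[of _ 0])
    ultimately show False using n by auto
  qed
  have it: "inj_on (tail G) S"
  proof (rule inj_onI)
    fix a b assume ab: "a \<in> S" "b \<in> S" "tail G a = tail G b"
    have aH: "a \<in> arcs H" "b \<in> arcs H" using ab SH by auto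
    show "a = b"
    proof (rule ccontr)
      assume "a \<noteq> b"
      have "head G (arev a) = tail G b" using ab(3) aG[OF aH(1)] by simp
      then have "b = nxt (arev a) \<or> b = arev (arev a)" by (intro nxt(4) D(5) aH) simp
      then have b: "b = nxt (arev a)" using \<open>a \<noteq> b\<close> by simp
      from surj ab(2) obtain c where c: "c \<in> S" "b = nxt c" by auto
      then have "c = arev a" using b inj_onD[OF inj] SH D(5)[OF aH(1)] by auto
      then show False using c Sa[OF ab(1)] by simp
    qed
  qed
  have ih: "inj_on (head G) S"
  proof (rule inj_onI)
    fix a b assume ab: "a \<in> S" "b \<in> S" "head G a = head G b"
    then have "tail G (nxt a) = tail G (nxt b)" using nxt(2) SH by (metis subsetD)
    then have "nxt a = nxt b" using inj_onD[OF it] Sn ab by blast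
    then show "a = b" using inj_onD[OF injS] ab by blast
  qed
  have "tail G ` S = tail G ` nxt ` S" by (simp add: surj)
  also have "\<dots> = head G ` S" using nxt(2) SH by (auto simp: image_image subset_iff intro!: image_cong)
  finally have "cyclic S" using it ih SH D(3) by (auto simp: cyclic_def)
  then have "oriented S" using Sa by (simp add: oriented_def)
  moreover have "tail G ` S = verts H"
  proof
    show "tail G ` S \<subseteq> verts H" using SH D(6) by auto
    show "verts H \<subseteq> tail G ` S"
    proof
      fix v assume "v \<in> verts H"
      then obtain e where e: "e \<in> arcs H" "v = tail G e" using D(8) by auto
      show "v \<in> tail G ` S"
      proof (cases "e \<in> S")
        case False
        then have "arev e \<in> S" using cover[OF e(1)] by simp
        then have "nxt (arev e) \<in> S" "tail G (nxt (arev e)) = v"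
          using Sn nxt(2)[OF D(5)[OF e(1)]] aG[OF e(1)] e(2) by auto
        then show ?thesis by auto
      qed (use e in auto)
    qed
  qed
  ultimately show ?thesis by blast
qed

lemma all_oriented_iff_all_degree_2:
  "(\<forall>S. oriented S \<longrightarrow> matching_sum S = 0) \<longleftrightarrow>
    (\<forall>\<gamma>. degree_subgraph 2 G arev \<gamma> \<longrightarrow>
      poly (matching_poly (delete_subgraph G \<gamma>) arev w pot) (complex_of_real l) = 0)"
proof (intro iffI allI impI)
  fix \<gamma> assume "\<forall>S. oriented S \<longrightarrow> matching_sum S = 0" "degree_subgraph 2 G arev \<gamma>"
  then show "poly (matching_poly (delete_subgraph G \<gamma>) arev w pot) (complex_of_real l) = 0"
    using degree_2_has_orientation poly_matching_poly_delete by (metis oriented_def cyclicD(1))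
next
  fix S assume "\<forall>\<gamma>. degree_subgraph 2 G arev \<gamma> \<longrightarrow>
      poly (matching_poly (delete_subgraph G \<gamma>) arev w pot) (complex_of_real l) = 0" "oriented S"
  then show "matching_sum S = 0"
    using degree_2_of_oriented poly_matching_poly_delete by (metis oriented_def cyclicD(1))
qed

end


section \<open>Free reduction of walks\<close>

locale free_reduction =
  fixes arev :: "'e \<Rightarrow> 'e"
  assumes arev_arev [simp]: "arev (arev e) = e"
begin

definition walk_inv :: "'e list \<Rightarrow> 'e list" where
  "walk_inv p = rev (map arev p)"

lemma reduced_Nil [simp]: "reduced arev []"
  by (simp add: reduced_def)

lemma reduced_snoc: "reduced arev (p @ [e]) \<longleftrightarrow> reduced arev p \<and> (p = [] \<or> e \<noteq> arev (last p))"
  by (auto simp: reduced_def successively_append_iff)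

lemma append_arc_cancel [simp]: "append_arc arev (p @ [arev e]) e = p"
  by (simp add: append_arc_def)

lemma append_arc_cases:
  obtains (cancel) q where "p = q @ [arev e]" "append_arc arev p e = q"
  | (append) "append_arc arev p e = p @ [e]" "p = [] \<or> last p \<noteq> arev e"
proof (cases "p \<noteq> [] \<and> last p = arev e")
  case True
  then have "p = butlast p @ [arev e]" by (metis append_butlast_last_id)
  then show ?thesis using cancel[of "butlast p"] append_arc_cancel by metis
next
  case False
  then show ?thesis using append by (auto simp: append_arc_def)
qed

lemma reduced_append_arc: "reduced arev p \<Longrightarrow> reduced arev (append_arc arev p e)"
  by (cases rule: append_arc_cases[of p e]) (auto simp: reduced_snoc)

text \<open>
  If appending \<open>e\<close> cancels the last arc of \<open>p\<close>, the shortened walk cannot end in \<open>e\<close>, for \<open>p\<close> is reduced.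
  Thus appending \<open>arev e\<close> restores the last arc instead of cancelling another one.
\<close>

lemma append_arc_inverse:
  assumes "reduced arev p"
  shows "append_arc arev (append_arc arev p e) (arev e) = p"
proof (cases rule: append_arc_cases[of p e])
  case (cancel q)
  then have "q = [] \<or> last q \<noteq> e" using assms by (auto simp: reduced_snoc)
  then show ?thesis using cancel by (auto simp: append_arc_def)
next
  case append
  then show ?thesis using append_arc_cancel[of p "arev e"] by simp
qed

lemma walk_mult_Nil [simp]: "walk_mult arev p [] = p"
  and walk_mult_snoc: "walk_mult arev p (q @ [e]) = append_arc arev (walk_mult arev p q) e"
  and walk_mult_Cons: "walk_mult arev p (e # q) = walk_mult arev (append_arc arev p e) q"
  by (simp_all add: walk_mult_def)

lemma reduced_walk_mult: "reduced arev p \<Longrightarrow> reduced arev (walk_mult arev p q)"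
  by (induction q rule: rev_induct) (simp_all add: walk_mult_snoc reduced_append_arc)

lemma walk_mult_append_arc:
  assumes "reduced arev p"
  shows "walk_mult arev p (append_arc arev q e) = append_arc arev (walk_mult arev p q) e"
proof (cases rule: append_arc_cases[of q e])
  case (cancel q')
  have "append_arc arev (append_arc arev (walk_mult arev p q') (arev e)) e = walk_mult arev p q'"
    using append_arc_inverse[OF reduced_walk_mult[OF assms], of q' "arev e"] by simp
  then show ?thesis using cancel by (simp add: walk_mult_snoc)
next
  case append
  then show ?thesis by (simp add: walk_mult_snoc)
qed

text \<open>
  Concatenation followed by reduction acts one arc at a time, and \<open>append_arc\<close> with a fixed arc commutes
  with multiplication on the left.
\<close>

lemma walk_mult_assoc:
  assumes "reduced arev p"
  shows "walk_mult arev p (walk_mult arev q s) = walk_mult arev (walk_mult arev p q) s"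
  by (induction s rule: rev_induct) (simp_all add: walk_mult_snoc walk_mult_append_arc[OF assms])

lemma walk_mult_Nil_left: "reduced arev p \<Longrightarrow> walk_mult arev [] p = p"
proof (induction p rule: rev_induct)
  case (snoc e p)
  then have "p = [] \<or> last p \<noteq> arev e" by (auto simp: reduced_snoc)
  then show ?case using snoc by (auto simp: walk_mult_snoc reduced_snoc append_arc_def)
qed simp

lemma walk_inv_simps [simp]: "walk_inv [] = []" "walk_inv (p @ [e]) = arev e # walk_inv p"
  "walk_inv (walk_inv p) = p"
  by (simp_all add: walk_inv_def rev_map map_idI)

lemma reduced_walk_inv: "reduced arev p \<Longrightarrow> reduced arev (walk_inv p)"
  unfolding reduced_def walk_inv_def successively_rev successively_map
  by (erule successively_mono) auto

lemma walk_mult_inv_right: "walk_mult arev p (walk_inv p) = []"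
proof (induction p rule: rev_induct)
  case (snoc e p)
  have "append_arc arev (p @ [e]) (arev e) = p" using append_arc_cancel[of p "arev e"] by simp
  with snoc show ?case by (simp add: walk_mult_Cons)
qed simp

lemma walk_mult_inv_left: "walk_mult arev (walk_inv p) p = []"
  using walk_mult_inv_right[of "walk_inv p"] by simp

end

text \<open>
  In a product in which every factor occurs as often as its inverse, the first factor cancels against
  one of its inverses. The map \<open>a\<close> plays the role of arc reversal.
\<close>

lemma (in comm_group) balanced_product_is_one:
  assumes "\<And>e. e \<in> set p \<Longrightarrow> X e \<in> carrier G" "\<And>e. e \<in> set p \<Longrightarrow> X (a e) = inv (X e)"
    and "\<And>e. e \<in> set p \<Longrightarrow> a e \<noteq> e" "\<And>e. a (a e) = e"
    and "\<And>e. count_list p e = count_list p (a e)"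
  shows "foldr (\<lambda>e y. X e \<otimes> y) p \<one> = \<one>"
  using assms(1-3,5)
proof (induction "length p" arbitrary: p rule: less_induct)
  case less
  show ?case
  proof (cases p)
    case (Cons e q)
    have "a e \<noteq> e" using less.prems(3) Cons by simp
    moreover have "count_list p (a e) \<noteq> 0" using less.prems(4)[of e] Cons by simp
    ultimately have "a e \<in> set q" using Cons by (simp add: count_list_0_iff split: if_splits)
    then obtain ys zs where q: "q = ys @ a e # zs" by (meson split_list)
    have closed: "foldr (\<lambda>e y. X e \<otimes> y) l \<one> \<in> carrier G" if "set l \<subseteq> set p" for l
      using that by (induction l) (auto intro: less.prems(1))
    have app: "foldr (\<lambda>e y. X e \<otimes> y) (l @ m) \<one> = foldr (\<lambda>e y. X e \<otimes> y) l \<one> \<otimes> foldr (\<lambda>e y. X e \<otimes> y) m \<one>"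
      if "set (l @ m) \<subseteq> set p" for l m
      using that
    proof (induction l)
      case (Cons b l)
      then have "X b \<in> carrier G" "foldr (\<lambda>e y. X e \<otimes> y) l \<one> \<in> carrier G" "foldr (\<lambda>e y. X e \<otimes> y) m \<one> \<in> carrier G"
        using closed less.prems(1) by auto
      then show ?case using Cons by (simp add: m_assoc)
    qed (use closed in auto)
    have sub: "set ys \<subseteq> set p" "set zs \<subseteq> set p" "e \<in> set p" "a e \<in> set p" using Cons q by auto
    have c: "X e \<in> carrier G" "foldr (\<lambda>e y. X e \<otimes> y) ys \<one> \<in> carrier G" "foldr (\<lambda>e y. X e \<otimes> y) zs \<one> \<in> carrier G"
      using closed sub less.prems(1) by auto
    have "foldr (\<lambda>e y. X e \<otimes> y) p \<one> = X e \<otimes> (foldr (\<lambda>e y. X e \<otimes> y) ys \<one> \<otimes> (inv (X e) \<otimes> foldr (\<lambda>e y. X e \<otimes> y) zs \<one>))"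
      using Cons q app[of ys "a e # zs"] less.prems(2)[OF sub(3)] sub by simp
    also have "\<dots> = X e \<otimes> (inv (X e) \<otimes> (foldr (\<lambda>e y. X e \<otimes> y) ys \<one> \<otimes> foldr (\<lambda>e y. X e \<otimes> y) zs \<one>))"
      using c by (simp add: m_lcomm)
    also have "\<dots> = foldr (\<lambda>e y. X e \<otimes> y) ys \<one> \<otimes> foldr (\<lambda>e y. X e \<otimes> y) zs \<one>"
      using c by (simp add: m_assoc[symmetric])
    also have "\<dots> = foldr (\<lambda>e y. X e \<otimes> y) (ys @ zs) \<one>"
      using app[of ys zs] sub by simp
    also have "\<dots> = \<one>"
    proof (rule less.hyps)
      show "length (ys @ zs) < length p" using Cons q by simp
      fix f
      have "count_list p f = count_list (ys @ zs) f + (if e = f then 1 else 0) + (if a e = f then 1 else 0)" for f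
        using Cons q by simp
      moreover have "e = a f \<longleftrightarrow> a e = f" using assms(4) by metis
      moreover have "a e = a f \<longleftrightarrow> e = f" using assms(4) by metis
      ultimately show "count_list (ys @ zs) f = count_list (ys @ zs) (a f)"
        using less.prems(4)[of f] by simp
    qed (use less.prems Cons q in auto)
    finally show ?thesis .
  qed simp
qed


section \<open>The fundamental group and zero chains\<close>

locale based_graph = weighted_graph G arev w pot l \<nu>
  for G :: "('v, 'e) pre_digraph" and arev w pot l \<nu> +
  fixes r :: 'v
  assumes connected: "Digraph_Component.connected G" and r_in: "r \<in> verts G"
begin

sublocale walks: free_reduction arev
  by unfold_locales simp

abbreviation "wmul \<equiv> walk_mult arev"
abbreviation "winv \<equiv> walks.walk_inv"
abbreviation "wend \<equiv> walk_end G r"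

lemma awalk_snoc: "awalk u (p @ [e]) x \<longleftrightarrow> awalk u p (tail G e) \<and> e \<in> arcs G \<and> x = head G e"
  by (auto simp: awalk_Cons_iff awalk_Nil_iff)

lemma awalk_append_arc:
  assumes "awalk u p v" "e \<in> arcs G" "tail G e = v"
  shows "awalk u (append_arc arev p e) (head G e)"
proof (cases rule: walks.append_arc_cases[of p e])
  case (cancel q)
  then show ?thesis using assms by (simp add: awalk_snoc del: awalk_append_iff)
next
  case append
  then show ?thesis using assms by (simp add: awalk_snoc del: awalk_append_iff)
qed

lemma awalk_walk_mult:
  assumes "awalk u p v" "awalk v q x"
  shows "awalk u (wmul p q) x"
  using assms(2)
proof (induction q arbitrary: x rule: rev_induct)
  case Nil
  then show ?case using assms(1) by (simp add: awalk_Nil_iff)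
next
  case (snoc e q)
  then show ?case
    using awalk_append_arc[of u "wmul p q" "tail G e" e]
    by (simp add: awalk_snoc walks.walk_mult_snoc del: awalk_append_iff)
qed

lemma awalk_walk_inv:
  assumes "awalk u p v"
  shows "awalk v (winv p) u"
  using assms
proof (induction p arbitrary: v rule: rev_induct)
  case Nil
  then show ?case by (auto simp: awalk_Nil_iff)
next
  case (snoc e p)
  then show ?case by (simp add: awalk_snoc awalk_Cons_iff del: awalk_append_iff)
qed

lemma wend_awalk: "awalk r p v \<Longrightarrow> wend p = v"
  by (simp add: walk_end_def)

text \<open>
  The reduced walks from \<open>r\<close> to \<open>v\<close> are the vertices of the universal cover above \<open>v\<close>.
\<close>

definition rwalk :: "'v \<Rightarrow> 'e list \<Rightarrow> bool" where
  "rwalk v p \<longleftrightarrow> awalk r p v \<and> reduced arev p"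

lemma rwalkD:
  assumes "rwalk v p"
  shows "awalk r p v" "reduced arev p" "wend p = v" "v \<in> verts G"
  using assms wend_awalk by (auto simp: rwalk_def)

lemma rwalk_append_arc: "rwalk v p \<Longrightarrow> e \<in> arcs G \<Longrightarrow> tail G e = v \<Longrightarrow> rwalk (head G e) (append_arc arev p e)"
  unfolding rwalk_def by (blast intro: awalk_append_arc walks.reduced_append_arc)

lemma rwalk_walk_mult: "rwalk v p \<Longrightarrow> awalk v q x \<Longrightarrow> rwalk x (wmul p q)"
  by (auto simp: rwalk_def intro: awalk_walk_mult walks.reduced_walk_mult)

lemma rwalk_Nil: "rwalk r []"
  using r_in by (simp add: rwalk_def awalk_Nil_iff)

lemma ex_rwalk:
  assumes "v \<in> verts G"
  shows "\<exists>p. rwalk v p"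
proof -
  have "r \<rightarrow>\<^sup>*\<^bsub>G\<^esub> v"
    using connected assms r_in reachable_mk_symmetric_eq[OF sym_arcs]
    by (auto simp: connected_def strongly_connected_def)
  then obtain p where "awalk r p v" by (auto simp: reachable_awalk)
  then show ?thesis using rwalk_walk_mult[OF rwalk_Nil] by blast
qed

text \<open>
  The chain reached in the periodic graph by the lift of the walk that starts at the zero chain.
\<close>

definition displacement :: "'e list \<Rightarrow> chain" where
  "displacement p = sum_list (map (\<lambda>e. - arc_chain e) p)"

lemma displacement_simps [simp]: "displacement [] = 0" "displacement (p @ [e]) = displacement p - arc_chain e"
  by (simp_all add: displacement_def)

lemma displacement_append_arc: "displacement (append_arc arev p e) = displacement p - arc_chain e"
proof (cases rule: walks.append_arc_cases[of p e])
  case (cancel q)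
  then show ?thesis by (simp add: arc_chain_arev)
qed simp

lemma displacement_walk_mult: "displacement (wmul p q) = displacement p + displacement q"
  by (induction q rule: rev_induct) (simp_all add: walks.walk_mult_snoc displacement_append_arc)

lemma displacement_walk_inv: "displacement (winv p) = - displacement p"
  using displacement_walk_mult[of p "winv p"] by (simp add: walks.walk_mult_inv_right eq_neg_iff_add_eq_0 add.commute)

lemma lookup_displacement:
  assumes "set p \<subseteq> arcs G" "e \<in> arcs G"
  shows "Poly_Mapping.lookup (displacement p) (\<nu> e) = int (count_list p (arev e)) - int (count_list p e)"
  using assms(1)
proof (induction p)
  case (Cons x p)
  have "Poly_Mapping.lookup (arc_chain x) (\<nu> e) = (if x = e then 1 else 0) - (if x = arev e then 1 else 0)"
    by (rule lookup_arc_chain) (use Cons.prems assms(2) in auto)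
  then show ?case using Cons by (simp add: displacement_def lookup_minus lookup_add)
qed (simp add: displacement_def)

abbreviation "\<pi> \<equiv> pi1 G arev r"

lemma carrier_pi1: "carrier \<pi> = {g. rwalk r g}"
  by (auto simp: pi1_def rwalk_def)

lemma pi1_simps [simp]: "g \<otimes>\<^bsub>\<pi>\<^esub> h = wmul g h" "\<one>\<^bsub>\<pi>\<^esub> = []"
  by (simp_all add: pi1_def)

lemma rwalk_winv: "rwalk r g \<Longrightarrow> rwalk r (winv g)"
  by (simp add: rwalk_def awalk_walk_inv walks.reduced_walk_inv)

sublocale fundamental: group "pi1 G arev r"
proof (rule groupI)
  show "\<exists>y\<in>carrier \<pi>. y \<otimes>\<^bsub>\<pi>\<^esub> x = \<one>\<^bsub>\<pi>\<^esub>" if "x \<in> carrier \<pi>" for x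
    using that rwalk_winv[of x] walks.walk_mult_inv_left[of x] by (auto simp: carrier_pi1)
qed (auto simp: carrier_pi1 rwalk_def awalk_Nil_iff r_in awalk_walk_mult walks.reduced_walk_mult
    walks.walk_mult_assoc walks.walk_mult_Nil_left)

lemma inv_pi1: "g \<in> carrier \<pi> \<Longrightarrow> inv\<^bsub>\<pi>\<^esub> g = winv g"
  by (rule fundamental.inv_equality) (simp_all add: carrier_pi1 rwalk_winv walks.walk_mult_inv_left)

text \<open>
  The displacement is a homomorphism from the fundamental group to an abelian group.
\<close>

lemma derived_zero_chain: "derived \<pi> (carrier \<pi>) \<subseteq> {g\<in>carrier \<pi>. displacement g = 0}"
  unfolding derived_def
proof (rule fundamental.generate_subgroup_incl)
  show "subgroup {g\<in>carrier \<pi>. displacement g = 0} \<pi>"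
  proof
    fix x y assume "x \<in> {g\<in>carrier \<pi>. displacement g = 0}" "y \<in> {g\<in>carrier \<pi>. displacement g = 0}"
    then show "x \<otimes>\<^bsub>\<pi>\<^esub> y \<in> {g\<in>carrier \<pi>. displacement g = 0}"
      using fundamental.m_closed[of x y] by (simp add: displacement_walk_mult)
  next
    fix x assume "x \<in> {g\<in>carrier \<pi>. displacement g = 0}"
    then show "inv\<^bsub>\<pi>\<^esub> x \<in> {g\<in>carrier \<pi>. displacement g = 0}"
      using fundamental.inv_closed[of x] by (simp add: inv_pi1 displacement_walk_inv)
  qed (use fundamental.one_closed in auto)
  show "derived_set \<pi> (carrier \<pi>) \<subseteq> {g\<in>carrier \<pi>. displacement g = 0}"
  proof
    fix x assume x: "x \<in> derived_set \<pi> (carrier \<pi>)"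
    then obtain g h where gh: "g \<in> carrier \<pi>" "h \<in> carrier \<pi>"
      "x = g \<otimes>\<^bsub>\<pi>\<^esub> h \<otimes>\<^bsub>\<pi>\<^esub> inv\<^bsub>\<pi>\<^esub> g \<otimes>\<^bsub>\<pi>\<^esub> inv\<^bsub>\<pi>\<^esub> h" by blast
    have "x \<in> carrier \<pi>" using x fundamental.derived_set_in_carrier[OF subset_refl] by blast
    moreover have "displacement x = 0" using gh by (simp add: displacement_walk_mult inv_pi1 displacement_walk_inv)
    ultimately show "x \<in> {g\<in>carrier \<pi>. displacement g = 0}" by simp
  qed
qed

text \<open>
  Choose a walk \<open>t v\<close> from \<open>r\<close> to each vertex \<open>v\<close>, the empty one to \<open>r\<close>, and close every arc \<open>e\<close> to the
  loop \<open>t (tail e) e (t (head e))\<^sup>-\<^sup>1\<close>. A closed walk at \<open>r\<close> is the product of the loops of its arcs, as the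
  inserted walks cancel. Reversing an arc inverts its loop. If the chain is zero, each arc occurs as often
  as its reverse, and so the product is trivial in the abelianisation.
\<close>

lemma zero_chain_derived:
  assumes g: "g \<in> carrier \<pi>" "displacement g = 0"
  shows "g \<in> derived \<pi> (carrier \<pi>)"
proof -
  define D where "D = derived \<pi> (carrier \<pi>)"
  interpret D: normal D \<pi> unfolding D_def by (rule fundamental.derived_self_is_normal)
  define Q where "Q = \<pi> Mod D"
  interpret Q: comm_group Q unfolding Q_def D_def by (rule fundamental.derived_quot_is_comm_group)
  define cl where "cl g = D #>\<^bsub>\<pi>\<^esub> g" for g
  have cl_hom: "cl \<in> hom \<pi> Q"
    unfolding cl_def Q_def by (rule D.r_coset_hom_Mod)
  have cl_mult: "cl (wmul g h) = cl g \<otimes>\<^bsub>Q\<^esub> cl h" if "rwalk r g" "rwalk r h" for g h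
    using hom_mult[OF cl_hom, of g h] that by (simp add: carrier_pi1)
  have cl_closed: "cl g \<in> carrier Q" if "rwalk r g" for g
    using hom_in_carrier[OF cl_hom, of g] that by (simp add: carrier_pi1)
  define t where "t v = (if v = r then [] else SOME p. rwalk v p)" for v
  have t: "rwalk v (t v)" if "v \<in> verts G" for v
    using someI_ex[OF ex_rwalk[OF that]] by (simp add: t_def rwalk_Nil)
  have ti: "awalk v (winv (t v)) r" if "v \<in> verts G" for v
    using awalk_walk_inv[OF rwalkD(1)[OF t[OF that]]] .
  define loop where "loop e = wmul (wmul (t (tail G e)) [e]) (winv (t (head G e)))" for e
  have loop: "rwalk r (loop e)" if "e \<in> arcs G" for e
    unfolding loop_def
    by (rule rwalk_walk_mult[OF rwalk_walk_mult[OF t[of "tail G e"]] ti[of "head G e"]])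
      (use that in \<open>auto simp: awalk_Cons_iff awalk_Nil_iff\<close>)
  have close: "rwalk r (wmul P (winv (t v)))" if "rwalk v P" for P v
    by (rule rwalk_walk_mult[OF that ti[OF rwalkD(4)[OF that]]])
  \<comment> \<open>Closing up after one more arc multiplies by the loop of that arc.\<close>
  have ext: "wmul (wmul P (winv (t (tail G e)))) (loop e) = wmul (append_arc arev P e) (winv (t (head G e)))"
    if P: "rwalk (tail G e) P" and e: "e \<in> arcs G" for P e
  proof -
    let ?t = "t (tail G e)"
    have red: "reduced arev P" "reduced arev ?t" "reduced arev (wmul P (winv ?t))"
      using rwalkD(2)[OF P] rwalkD(2)[OF t[of "tail G e"]] e by (auto intro: walks.reduced_walk_mult)
    have "wmul (wmul P (winv ?t)) (wmul ?t [e]) = wmul (wmul P (wmul (winv ?t) ?t)) [e]"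
      using red by (simp add: walks.walk_mult_assoc)
    also have "\<dots> = append_arc arev P e"
      using walks.walk_mult_snoc[of P "[]" e] by (simp add: walks.walk_mult_inv_left)
    finally show ?thesis
      unfolding loop_def using red by (simp add: walks.walk_mult_assoc)
  qed
  let ?prod = "\<lambda>p. foldr (\<lambda>e y. cl (loop e) \<otimes>\<^bsub>Q\<^esub> y) p \<one>\<^bsub>Q\<^esub>"
  have prod_closed: "?prod p \<in> carrier Q" if "set p \<subseteq> arcs G" for p
    using that by (induction p) (auto intro!: Q.m_closed cl_closed loop)
  have prod_snoc: "?prod (p @ [e]) = ?prod p \<otimes>\<^bsub>Q\<^esub> cl (loop e)" if "set (p @ [e]) \<subseteq> arcs G" for p e
    using that
  proof (induction p)
    case Nil
    then show ?case using cl_closed[OF loop] by simp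
  next
    case (Cons b p)
    then show ?case
      using cl_closed[OF loop, of b] cl_closed[OF loop, of e] prod_closed[of p]
      by (simp add: Q.m_assoc)
  qed
  have tele: "cl (wmul (wmul [] p) (winv (t v))) = ?prod p" if "awalk r p v" for p v
    using that
  proof (induction p arbitrary: v rule: rev_induct)
    case Nil
    then have "v = r" by (simp add: awalk_Nil_iff)
    then show ?case using hom_one[OF cl_hom fundamental.group_axioms Q.group_axioms] by (simp add: t_def)
  next
    case (snoc e p)
    then have e: "awalk r p (tail G e)" "e \<in> arcs G" "v = head G e" by (simp_all add: awalk_snoc del: awalk_append_iff)
    have P: "rwalk (tail G e) (wmul [] p)"
      by (rule rwalk_walk_mult[OF rwalk_Nil e(1)])
    have "cl (wmul (wmul [] (p @ [e])) (winv (t v))) = cl (wmul (wmul (wmul [] p) (winv (t (tail G e)))) (loop e))"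
      using ext[OF P e(2)] e(3) by (simp add: walks.walk_mult_snoc)
    also have "\<dots> = cl (wmul (wmul [] p) (winv (t (tail G e)))) \<otimes>\<^bsub>Q\<^esub> cl (loop e)"
      by (rule cl_mult[OF close[OF P] loop[OF e(2)]])
    also have "\<dots> = ?prod (p @ [e])"
      using snoc.IH[OF e(1)] prod_snoc[of p e] e(1,2) awalkE'[OF e(1)] by (auto simp: awalk_def)
    finally show ?case .
  qed
  have w: "awalk r g r" "set g \<subseteq> arcs G" using g(1) by (auto simp: carrier_pi1 rwalk_def awalk_def)
  have "?prod g = \<one>\<^bsub>Q\<^esub>"
  proof (rule Q.balanced_product_is_one[where a = arev])
    fix e assume "e \<in> set g"
    then have e: "e \<in> arcs G" using w(2) by auto
    then show "cl (loop e) \<in> carrier Q" "arev e \<noteq> e" using arev_neq by (simp_all add: cl_closed loop)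
    have "wmul (loop (arev e)) (loop e) = []"
    proof -
      let ?a = "t (tail G e)" and ?b = "t (head G e)"
      have red: "reduced arev ?a" "reduced arev ?b" using e rwalkD(2)[OF t] by auto
      have "wmul (loop (arev e)) (loop e) = wmul (wmul (wmul ?b [arev e]) (winv ?a)) (wmul (wmul ?a [e]) (winv ?b))"
        using e by (simp add: loop_def)
      also have "\<dots> = wmul (wmul (wmul (wmul ?b [arev e]) (wmul (winv ?a) ?a)) [e]) (winv ?b)"
        using red by (simp add: walks.walk_mult_assoc walks.reduced_walk_mult)
      also have "wmul (wmul (wmul ?b [arev e]) (wmul (winv ?a) ?a)) [e] = ?b"
        using red walks.append_arc_inverse[OF red(2), of "arev e"]
        by (simp add: walks.walk_mult_inv_left walks.walk_mult_Cons)
      finally show ?thesis by (simp add: walks.walk_mult_inv_right)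
    qed
    then have "cl (loop (arev e)) \<otimes>\<^bsub>Q\<^esub> cl (loop e) = \<one>\<^bsub>Q\<^esub>"
      using cl_mult[OF loop loop, of "arev e" e] e hom_one[OF cl_hom fundamental.group_axioms Q.group_axioms] by simp
    then show "cl (loop (arev e)) = inv\<^bsub>Q\<^esub> cl (loop e)"
      using Q.inv_equality[OF _ cl_closed[OF loop] cl_closed[OF loop], of "arev e" e] e by simp
  next
    fix e
    show "count_list g e = count_list g (arev e)"
    proof (cases "e \<in> arcs G")
      case True
      then show ?thesis using lookup_displacement[OF w(2) True] g(2) by simp
    next
      case False
      then show ?thesis using arev_eq by simp
    qed
  qed simp
  then have "cl g = \<one>\<^bsub>Q\<^esub>"
    using tele[OF w(1)] g(1) by (simp add: t_def walks.walk_mult_Nil_left carrier_pi1 rwalk_def)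
  then have "D #>\<^bsub>\<pi>\<^esub> g = D" by (simp add: cl_def Q_def)
  then show ?thesis using g(1) fundamental.rcos_self[OF g(1) D.subgroup_axioms] by (simp add: D_def)
qed

end


section \<open>The maximal abelian cover\<close>

context based_graph
begin

abbreviation "T \<equiv> universal_cover G arev r"
abbreviation "Gab \<equiv> abelian_cover G arev r"

text \<open>
  The vertices of the maximal abelian cover are the nonempty sets of this form (\<open>verts_Gab\<close>): a fibre
  collects the reduced walks with a given end and displacement.
\<close>

definition fibre :: "'v \<Rightarrow> chain \<Rightarrow> 'e list set" where
  "fibre v k = {p. rwalk v p \<and> displacement p = k}"

lemma verts_universal_cover: "p \<in> verts T \<longleftrightarrow> rwalk (wend p) p"
  by (simp add: universal_cover_def rwalk_def)

text \<open>
  Two reduced walks with the same end and displacement differ by a closed walk with zero chain, which is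
  an element of the commutator subgroup.
\<close>

lemma commutator_orbit:
  assumes p: "rwalk v p"
  shows "Group_Action.orbit (commutator_pi1 G arev r) (deck_vert arev) p = fibre v (displacement p)"
proof
  let ?D = "derived \<pi> (carrier \<pi>)"
  show "Group_Action.orbit (commutator_pi1 G arev r) (deck_vert arev) p \<subseteq> fibre v (displacement p)"
  proof
    fix q assume "q \<in> Group_Action.orbit (commutator_pi1 G arev r) (deck_vert arev) p"
    then obtain g where g: "g \<in> ?D" "q = wmul g p"
      by (auto simp: Group_Action.orbit_def commutator_pi1_def deck_vert_def)
    then have "g \<in> carrier \<pi>" "displacement g = 0" using derived_zero_chain by auto
    then show "q \<in> fibre v (displacement p)"
      using rwalk_walk_mult[OF _ rwalkD(1)[OF p]] by (simp add: fibre_def g carrier_pi1 displacement_walk_mult)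
  qed
  show "fibre v (displacement p) \<subseteq> Group_Action.orbit (commutator_pi1 G arev r) (deck_vert arev) p"
  proof
    fix q assume "q \<in> fibre v (displacement p)"
    then have q: "rwalk v q" "displacement q = displacement p" by (auto simp: fibre_def)
    define g where "g = wmul q (winv p)"
    have "rwalk r g" unfolding g_def
      by (rule rwalk_walk_mult[OF q(1) awalk_walk_inv[OF rwalkD(1)[OF p]]])
    then have "g \<in> ?D"
      by (intro zero_chain_derived) (simp_all add: carrier_pi1 g_def displacement_walk_mult displacement_walk_inv q)
    moreover have "wmul g p = q"
      using walks.walk_mult_assoc[OF rwalkD(2)[OF q(1)], of "winv p" p]
      by (simp add: g_def walks.walk_mult_inv_left)
    ultimately show "q \<in> Group_Action.orbit (commutator_pi1 G arev r) (deck_vert arev) p"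
      unfolding Group_Action.orbit_def commutator_pi1_def deck_vert_def by auto
  qed
qed

lemma commutator_orbit_arc:
  assumes p: "rwalk v p"
  shows "Group_Action.orbit (commutator_pi1 G arev r) (deck_arc arev) (p, e) = fibre v (displacement p) \<times> {e}"
proof -
  have "Group_Action.orbit (commutator_pi1 G arev r) (deck_arc arev) (p, e) =
      Group_Action.orbit (commutator_pi1 G arev r) (deck_vert arev) p \<times> {e}"
    by (auto simp: Group_Action.orbit_def deck_arc_def deck_vert_def)
  then show ?thesis using commutator_orbit[OF p] by simp
qed

lemma verts_Gab: "verts Gab = {fibre v k | v k. fibre v k \<noteq> {}}"
proof -
  have "verts Gab = {Group_Action.orbit (commutator_pi1 G arev r) (deck_vert arev) p | p. p \<in> verts T}"
    by (auto simp: abelian_cover_def quotient_graph_def orbits_def)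
  also have "\<dots> = {fibre (wend p) (displacement p) | p. rwalk (wend p) p}"
    using commutator_orbit unfolding verts_universal_cover by blast
  also have "\<dots> = {fibre v k | v k. fibre v k \<noteq> {}}"
  proof (intro subset_antisym subsetI)
    fix X assume "X \<in> {fibre v k | v k. fibre v k \<noteq> {}}"
    then obtain v k p where "X = fibre v k" "p \<in> fibre v k" by blast
    then have "rwalk v p" "displacement p = k" "wend p = v" "X = fibre (wend p) (displacement p)" by (auto simp: fibre_def rwalkD)
    then show "X \<in> {fibre (wend p) (displacement p) | p. rwalk (wend p) p}" by blast
  next
    fix X assume "X \<in> {fibre (wend p) (displacement p) | p. rwalk (wend p) p}"
    then obtain p where "X = fibre (wend p) (displacement p)" "p \<in> fibre (wend p) (displacement p)" by (auto simp: fibre_def)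
    then show "X \<in> {fibre v k | v k. fibre v k \<noteq> {}}" by blast
  qed
  finally show ?thesis .
qed

lemma arcs_Gab: "arcs Gab = {fibre (tail G e) k \<times> {e} | e k. e \<in> arcs G \<and> fibre (tail G e) k \<noteq> {}}"
proof -
  have "arcs Gab = {Group_Action.orbit (commutator_pi1 G arev r) (deck_arc arev) (p, e) | p e. rwalk (tail G e) p \<and> e \<in> arcs G}"
  proof -
    have "arcs T = {(p, e). rwalk (tail G e) p \<and> e \<in> arcs G}"
    proof -
      have "awalk r p (wend p) \<and> tail G e = wend p \<longleftrightarrow> awalk r p (tail G e)" for p e
        using wend_awalk by metis
      then show ?thesis by (auto simp: universal_cover_def rwalk_def)
    qed
    then show ?thesis by (auto simp: abelian_cover_def quotient_graph_def orbits_def)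
  qed
  also have "\<dots> = {fibre (tail G e) (displacement p) \<times> {e} | p e. rwalk (tail G e) p \<and> e \<in> arcs G}"
    using commutator_orbit_arc by blast
  also have "\<dots> = {fibre (tail G e) k \<times> {e} | e k. e \<in> arcs G \<and> fibre (tail G e) k \<noteq> {}}"
    unfolding fibre_def by blast
  finally show ?thesis .
qed

text \<open>
  Every walk to the head arises because appending the reverse arc undoes the step.
\<close>

lemma fibre_step:
  assumes "e \<in> arcs G"
  shows "(\<lambda>p. append_arc arev p e) ` fibre (tail G e) k = fibre (head G e) (k - arc_chain e)"
proof
  show "(\<lambda>p. append_arc arev p e) ` fibre (tail G e) k \<subseteq> fibre (head G e) (k - arc_chain e)"
    using rwalk_append_arc[OF _ assms refl] by (auto simp: fibre_def displacement_append_arc)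
  show "fibre (head G e) (k - arc_chain e) \<subseteq> (\<lambda>p. append_arc arev p e) ` fibre (tail G e) k"
  proof
    fix q assume "q \<in> fibre (head G e) (k - arc_chain e)"
    then have q: "rwalk (head G e) q" "displacement q = k - arc_chain e" by (auto simp: fibre_def)
    define p where "p = append_arc arev q (arev e)"
    have "rwalk (tail G e) p"
      using rwalk_append_arc[OF q(1), of "arev e"] assms by (simp add: p_def)
    moreover have "displacement p = k" by (simp add: p_def displacement_append_arc q arc_chain_arev)
    moreover have "append_arc arev p e = q"
      using walks.append_arc_inverse[OF rwalkD(2)[OF q(1)], of "arev e"] by (simp add: p_def)
    ultimately show "q \<in> (\<lambda>p. append_arc arev p e) ` fibre (tail G e) k"
      by (auto simp: fibre_def)
  qed
qed

lemma tail_head_Gab: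
  assumes "e \<in> arcs G" "fibre (tail G e) k \<noteq> {}"
  shows "tail Gab (fibre (tail G e) k \<times> {e}) = fibre (tail G e) k"
    "head Gab (fibre (tail G e) k \<times> {e}) = fibre (head G e) (k - arc_chain e)"
proof -
  show "tail Gab (fibre (tail G e) k \<times> {e}) = fibre (tail G e) k"
    by (force simp: abelian_cover_def quotient_graph_def universal_cover_def)
  have "head Gab (fibre (tail G e) k \<times> {e}) = (\<lambda>p. append_arc arev p e) ` fibre (tail G e) k"
    by (force simp: abelian_cover_def quotient_graph_def universal_cover_def)
  then show "head Gab (fibre (tail G e) k \<times> {e}) = fibre (head G e) (k - arc_chain e)"
    by (simp add: fibre_step[OF assms(1)])
qed

lemma fibre_inject:
  assumes "fibre v k \<noteq> {}"
  shows "fibre v k = fibre v' k' \<longleftrightarrow> v = v' \<and> k = k'"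
proof
  assume eq: "fibre v k = fibre v' k'"
  from assms obtain p where "p \<in> fibre v k" by auto
  then have "p \<in> fibre v k" "p \<in> fibre v' k'" using eq by auto
  then show "v = v' \<and> k = k'" using rwalkD(3) by (auto simp: fibre_def)
qed auto

lemma ab_vert_fibre: "fibre v k \<noteq> {} \<Longrightarrow> ab_vert G r (fibre v k) = v"
proof -
  assume "fibre v k \<noteq> {}"
  then have "wend ` fibre v k = {v}" using rwalkD(3) by (force simp: fibre_def)
  then show ?thesis by (simp add: ab_vert_def)
qed

lemma ab_arc_fibre: "fibre v k \<noteq> {} \<Longrightarrow> ab_arc (fibre v k \<times> {e}) = e"
proof -
  assume "fibre v k \<noteq> {}"
  then have "snd ` (fibre v k \<times> {e}) = {e}" by force
  then show ?thesis by (simp add: ab_arc_def)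
qed

text \<open>
  The arcs leaving \<open>fibre u k\<close> are the lifts of the arcs leaving \<open>u\<close>. Several of them may have the same
  head, so the sum over the vertices of the cover regroups the sum over arcs.
\<close>

lemma schroedinger_Gab:
  assumes ne: "fibre u k \<noteq> {}"
  shows "schroedinger Gab (w \<circ> ab_arc) (pot \<circ> ab_vert G r) f (fibre u k) =
    (\<Sum>e\<in>out_arcs G u. w e * f (fibre (head G e) (k - arc_chain e))) + complex_of_real (pot u) * f (fibre u k)"
proof -
  define nb where "nb e = fibre (head G e) (k - arc_chain e)" for e
  have nbV: "nb e \<in> verts Gab" if "e \<in> out_arcs G u" for e
    using fibre_step[of e k] that ne unfolding verts_Gab nb_def by fastforce
  have uV: "fibre u k \<in> verts Gab" using ne by (auto simp: verts_Gab)
  have arcs_out: "{a \<in> arcs Gab. tail Gab a = fibre u k \<and> head Gab a = Y} =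
      (\<lambda>e. fibre u k \<times> {e}) ` {e\<in>out_arcs G u. nb e = Y}" for Y
  proof (intro subset_antisym subsetI)
    fix a assume a: "a \<in> {a \<in> arcs Gab. tail Gab a = fibre u k \<and> head Gab a = Y}"
    then obtain e k' where e: "a = fibre (tail G e) k' \<times> {e}" "e \<in> arcs G" "fibre (tail G e) k' \<noteq> {}"
      by (auto simp: arcs_Gab)
    then have "fibre (tail G e) k' = fibre u k" "fibre (head G e) (k' - arc_chain e) = Y"
      using a tail_head_Gab[OF e(2,3)] by auto
    moreover from this(1) have "tail G e = u" "k' = k" using fibre_inject[OF e(3)] by auto
    ultimately show "a \<in> (\<lambda>e. fibre u k \<times> {e}) ` {e\<in>out_arcs G u. nb e = Y}"
      using e by (auto simp: nb_def)
  next
    fix a assume "a \<in> (\<lambda>e. fibre u k \<times> {e}) ` {e\<in>out_arcs G u. nb e = Y}"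
    then obtain e where e: "a = fibre (tail G e) k \<times> {e}" "e \<in> arcs G" "tail G e = u" "nb e = Y" by auto
    then show "a \<in> {a \<in> arcs Gab. tail Gab a = fibre u k \<and> head Gab a = Y}"
    proof -
      have ne': "fibre (tail G e) k \<noteq> {}" using ne e(3) by simp
      then have "a \<in> arcs Gab" unfolding arcs_Gab e(1) using e(2) by blast
      then show ?thesis using tail_head_Gab[OF e(2) ne'] e by (simp add: nb_def)
    qed
  qed
  have inj: "inj_on (\<lambda>e. fibre u k \<times> {e}) X" for X using ne by (auto simp: inj_on_def)
  have entry: "schroedinger_entry Gab (w \<circ> ab_arc) (pot \<circ> ab_vert G r) (fibre u k) Y =
      (\<Sum>e | e \<in> out_arcs G u \<and> nb e = Y. w e) + (if fibre u k = Y then complex_of_real (pot u) else 0)" for Y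
    unfolding schroedinger_entry_def arcs_out
    by (subst sum.reindex[OF inj]) (auto simp: ab_arc_fibre[OF ne] ab_vert_fibre[OF ne])
  define Z where "Z = insert (fibre u k) (nb ` out_arcs G u)"
  have finZ: "finite Z" unfolding Z_def by (intro finite.insertI finite_imageI finite_out_arcs)
  have ZV: "Z \<subseteq> verts Gab" using nbV uV by (auto simp: Z_def)
  have "schroedinger Gab (w \<circ> ab_arc) (pot \<circ> ab_vert G r) f (fibre u k) =
      infsum (\<lambda>Y. ((\<Sum>e | e \<in> out_arcs G u \<and> nb e = Y. w e) + (if fibre u k = Y then complex_of_real (pot u) else 0)) * f Y) Z"
    unfolding schroedinger_def entry
  proof (rule infsum_cong_neutral)
    fix Y assume "Y \<in> verts Gab - Z"
    then have "{e. e \<in> out_arcs G u \<and> nb e = Y} = {}" "fibre u k \<noteq> Y" by (auto simp: Z_def)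
    then show "((\<Sum>e | e \<in> out_arcs G u \<and> nb e = Y. w e) + (if fibre u k = Y then complex_of_real (pot u) else 0)) * f Y = 0"
      by (simp only: sum.empty if_False) simp
  qed (use ZV in auto)
  also have "\<dots> = (\<Sum>Y\<in>Z. ((\<Sum>e | e \<in> out_arcs G u \<and> nb e = Y. w e) + (if fibre u k = Y then complex_of_real (pot u) else 0)) * f Y)"
    by (rule infsum_finite[OF finZ])
  also have "\<dots> = (\<Sum>Y\<in>Z. \<Sum>e | e \<in> out_arcs G u \<and> nb e = Y. w e * f (nb e)) +
      (\<Sum>Y\<in>Z. if fibre u k = Y then complex_of_real (pot u) * f Y else 0)"
  proof -
    have "((\<Sum>e | e \<in> out_arcs G u \<and> nb e = Y. w e) + (if fibre u k = Y then complex_of_real (pot u) else 0)) * f Y =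
      (\<Sum>e | e \<in> out_arcs G u \<and> nb e = Y. w e * f (nb e)) + (if fibre u k = Y then complex_of_real (pot u) * f Y else 0)" for Y
    proof -
      have "(\<Sum>e | e \<in> out_arcs G u \<and> nb e = Y. w e) * f Y = (\<Sum>e | e \<in> out_arcs G u \<and> nb e = Y. w e * f (nb e))"
        unfolding sum_distrib_right by (rule sum.cong) auto
      then show ?thesis by (simp add: distrib_right)
    qed
    then show ?thesis by (simp add: sum.distrib)
  qed
  also have "(\<Sum>Y\<in>Z. \<Sum>e | e \<in> out_arcs G u \<and> nb e = Y. w e * f (nb e)) = (\<Sum>e\<in>out_arcs G u. w e * f (nb e))"
    by (rule sum.group) (auto simp: finZ Z_def)
  also have "(\<Sum>Y\<in>Z. if fibre u k = Y then complex_of_real (pot u) * f Y else 0) = complex_of_real (pot u) * f (fibre u k)"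
    using finZ by (simp add: Z_def)
  finally show ?thesis unfolding nb_def .
qed

abbreviation "cover_eigenvalue \<equiv>
  schroedinger_eigenvalue Gab (w \<circ> ab_arc) (pot \<circ> ab_vert G r) (complex_of_real l)"

text \<open>
  An eigenfunction on the cover is extended by zero to the pairs that no walk from \<open>r\<close> reaches. A pair is
  reached if and only if its neighbours are, so the extension still satisfies the eigenvalue equation.
\<close>

lemma cover_eigenvalue_imp_eigenfunction:
  assumes cover_eigenvalue
  obtains F C v k where "eigenfunction F" "square_bounded F C" "v \<in> verts G" "F (v, k) \<noteq> 0"
proof -
  obtain f X where f: "f \<in> ell2_on (verts Gab)" and X: "X \<in> verts Gab" "f X \<noteq> 0"
    and ev: "\<And>Y. Y \<in> verts Gab \<Longrightarrow> schroedinger Gab (w \<circ> ab_arc) (pot \<circ> ab_vert G r) f Y = complex_of_real l * f Y"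
    using assms unfolding schroedinger_eigenvalue_def by blast
  define F where "F = (\<lambda>(v, k). if fibre v k \<noteq> {} then f (fibre v k) else 0)"
  have "eigenfunction F"
    unfolding eigenfunction_def
  proof (intro ballI allI)
    fix u k assume "u \<in> verts G"
    have ne: "fibre (head G e) (k - arc_chain e) \<noteq> {} \<longleftrightarrow> fibre u k \<noteq> {}" if "e \<in> out_arcs G u" for e
      using fibre_step[of e k] that by (metis image_is_empty in_out_arcs_conv)
    show "eigen_equation F u k"
    proof (cases "fibre u k = {}")
      case True
      then have "(\<Sum>e\<in>out_arcs G u. w e * F (head G e, k - arc_chain e)) = 0"
        by (intro sum.neutral ballI) (use ne in \<open>simp add: F_def\<close>)
      then show ?thesis using True by (simp add: eigen_equation_def F_def)
    next
      case False
      then have "fibre u k \<in> verts Gab" by (auto simp: verts_Gab)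
      moreover have "(\<Sum>e\<in>out_arcs G u. w e * F (head G e, k - arc_chain e)) =
          (\<Sum>e\<in>out_arcs G u. w e * f (fibre (head G e) (k - arc_chain e)))"
        by (intro sum.cong refl) (use ne False in \<open>simp add: F_def\<close>)
      ultimately show ?thesis
        using ev[of "fibre u k"] schroedinger_Gab[OF False, of f] False by (simp add: eigen_equation_def F_def)
    qed
  qed
  moreover have "square_bounded F (infsum (\<lambda>v. (cmod (f v))\<^sup>2) (verts Gab))"
    unfolding square_bounded_def
  proof (intro allI impI)
    fix S :: "('v \<times> chain) set" assume S: "finite S"
    define S' where "S' = {x\<in>S. fibre (fst x) (snd x) \<noteq> {}}"
    have "(\<Sum>x\<in>S. (cmod (F x))\<^sup>2) = (\<Sum>x\<in>S'. (cmod (f (fibre (fst x) (snd x))))\<^sup>2)"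
      by (rule sum.mono_neutral_cong_right) (auto simp: S S'_def F_def split: if_splits)
    also have "\<dots> = (\<Sum>Y\<in>(\<lambda>x. fibre (fst x) (snd x)) ` S'. (cmod (f Y))\<^sup>2)"
      by (subst sum.reindex) (auto simp: inj_on_def S'_def fibre_inject)
    also have "\<dots> \<le> infsum (\<lambda>v. (cmod (f v))\<^sup>2) (verts Gab)"
      by (rule finite_sum_le_infsum) (use f S in \<open>auto simp: ell2_on_def S'_def verts_Gab\<close>)
    finally show "(\<Sum>x\<in>S. (cmod (F x))\<^sup>2) \<le> infsum (\<lambda>v. (cmod (f v))\<^sup>2) (verts Gab)" .
  qed
  moreover obtain v k where vk: "X = fibre v k" "fibre v k \<noteq> {}" using X(1) by (auto simp: verts_Gab)
  moreover have "v \<in> verts G" using vk(2) rwalkD(4) by (auto simp: fibre_def)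
  moreover have "F (v, k) \<noteq> 0" using X(2) vk by (simp add: F_def)
  ultimately show thesis using that by blast
qed

text \<open>
  Translating by \<open>k - displacement p\<close> moves a point where \<open>g\<close> does not vanish to the point reached by the
  walk \<open>p\<close>; then the restriction to the reachable pairs is not zero.
\<close>

lemma eigenfunction_imp_cover_eigenvalue:
  assumes g: "eigenfunction g" "finite {x. g x \<noteq> 0}" "v \<in> verts G" "g (v, k) \<noteq> 0"
  shows cover_eigenvalue
proof -
  obtain p where p: "rwalk v p" using ex_rwalk[OF g(3)] by blast
  define h where "h = (\<lambda>(x, k'). g (x, k' + (k - displacement p)))"
  have h: "eigenfunction h" unfolding h_def by (rule eigenfunction_translate[OF g(1)])
  have hfin: "finite {x. h x \<noteq> 0}"
  proof (rule finite_subset)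
    show "{x. h x \<noteq> 0} \<subseteq> (\<lambda>(x, k'). (x, k' - (k - displacement p))) ` {x. g x \<noteq> 0}"
    proof
      fix y assume "y \<in> {x. h x \<noteq> 0}"
      then have "g (fst y, snd y + (k - displacement p)) \<noteq> 0" by (simp add: h_def split: prod.splits)
      then show "y \<in> (\<lambda>(x, k'). (x, k' - (k - displacement p))) ` {x. g x \<noteq> 0}"
        by (intro image_eqI[of _ _ "(fst y, snd y + (k - displacement p))"]) auto
    qed
  qed (use g(2) in simp)
  define f where "f X = h (ab_vert G r X, the_elem (displacement ` X))" for X
  have displacement_fibre: "the_elem (displacement ` fibre v k) = k" if "fibre v k \<noteq> {}" for v k
  proof -
    have "displacement ` fibre v k = {k}" using that by (force simp: fibre_def)
    then show ?thesis by simp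
  qed
  have f_fibre: "f (fibre v k) = h (v, k)" if "fibre v k \<noteq> {}" for v k
    using that by (simp add: f_def ab_vert_fibre displacement_fibre)
  have "{X\<in>verts Gab. f X \<noteq> 0} \<subseteq> (\<lambda>(v, k). fibre v k) ` {x. h x \<noteq> 0}"
  proof
    fix X assume "X \<in> {X\<in>verts Gab. f X \<noteq> 0}"
    then obtain v k where X: "X = fibre v k" "fibre v k \<noteq> {}" "f X \<noteq> 0" by (auto simp: verts_Gab)
    then have "h (v, k) \<noteq> 0" using f_fibre[OF X(2)] by simp
    with X(1) show "X \<in> (\<lambda>(v, k). fibre v k) ` {x. h x \<noteq> 0}"
      by (intro image_eqI[of _ _ "(v, k)"]) auto
  qed
  then have fin: "finite {X\<in>verts Gab. f X \<noteq> 0}" by (rule finite_subset) (simp add: hfin)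
  have "f \<in> ell2_on (verts Gab)"
  proof -
    have "(\<lambda>X. (cmod (f X))\<^sup>2) summable_on {X\<in>verts Gab. f X \<noteq> 0}" using fin by simp
    then have "(\<lambda>X. (cmod (f X))\<^sup>2) summable_on verts Gab"
      by (rule summable_on_cong_neutral[THEN iffD1, rotated -1]) auto
    then show ?thesis by (simp add: ell2_on_def)
  qed
  moreover have "\<exists>X\<in>verts Gab. f X \<noteq> 0"
  proof -
    have ne: "fibre v (displacement p) \<noteq> {}" using p by (auto simp: fibre_def)
    then have "f (fibre v (displacement p)) \<noteq> 0" using g(4) by (simp add: f_fibre h_def)
    then show ?thesis using ne by (auto simp: verts_Gab)
  qed
  moreover have "schroedinger Gab (w \<circ> ab_arc) (pot \<circ> ab_vert G r) f X = complex_of_real l * f X"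
    if XV: "X \<in> verts Gab" for X
  proof -
    obtain u k where X: "X = fibre u k" "fibre u k \<noteq> {}" using XV by (auto simp: verts_Gab)
    then have "u \<in> verts G" using rwalkD(4) by (auto simp: fibre_def)
    have ne: "fibre (head G e) (k - arc_chain e) \<noteq> {}" if "e \<in> out_arcs G u" for e
      using fibre_step[of e k] that X(2) by (metis image_is_empty in_out_arcs_conv)
    have "(\<Sum>e\<in>out_arcs G u. w e * f (fibre (head G e) (k - arc_chain e))) = (\<Sum>e\<in>out_arcs G u. w e * h (head G e, k - arc_chain e))"
      by (intro sum.cong refl) (simp add: f_fibre ne)
    then show ?thesis
      using h \<open>u \<in> verts G\<close> schroedinger_Gab[OF X(2), of f]
      by (simp add: X f_fibre eigenfunction_def eigen_equation_def)
  qed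
  ultimately show ?thesis unfolding schroedinger_eigenvalue_def by blast
qed

end


section \<open>The point spectrum of the maximal abelian cover\<close>

theorem theorem1p1:
  fixes G :: "('v, 'e) pre_digraph"
    and arev :: "'e \<Rightarrow> 'e"
    and r :: 'v
    and w :: "'e \<Rightarrow> complex"
    and pot :: "'v \<Rightarrow> real"
    and l :: real
  assumes "fin_digraph G"
    and "bidirected_digraph G arev"
    and "Digraph_Component.connected G"
    and "r \<in> verts G"
    and "schroedinger_weight G arev w"
  shows "schroedinger_eigenvalue (abelian_cover G arev r)
           (w \<circ> ab_arc) (pot \<circ> ab_vert G r) (complex_of_real l)
         \<longleftrightarrow>
         (\<forall>\<gamma>. degree_subgraph 2 G arev \<gamma> \<longrightarrow>
            poly (matching_poly (delete_subgraph G \<gamma>) arev w pot) (complex_of_real l) = 0)"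
proof -
  interpret fin_digraph G by fact
  interpret bidirected_digraph G arev by fact
  obtain \<nu> :: "'e \<Rightarrow> nat" where \<nu>: "inj_on \<nu> (arcs G)"
    using finite_imp_inj_to_nat_seg[OF finite_arcs] by auto
  interpret based_graph G arev w pot l \<nu> r
  proof unfold_locales
    show "w e \<noteq> 0" if "e \<in> arcs G" for e
      using assms(5) that unfolding schroedinger_weight_def by blast
  qed (fact \<nu> assms)+
  have "cover_eigenvalue \<longleftrightarrow> (\<exists>g v k. eigenfunction g \<and> finite {x. g x \<noteq> 0} \<and> v \<in> verts G \<and> g (v, k) \<noteq> 0)"
  proof
    assume cover_eigenvalue
    then obtain F C v k where F: "eigenfunction F" "square_bounded F C" "v \<in> verts G" "F (v, k) \<noteq> 0"
      by (rule cover_eigenvalue_imp_eigenfunction)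
    from F obtain g v k where "eigenfunction g" "finite {x. g x \<noteq> 0}" "v \<in> verts G" "g (v, k) \<noteq> 0"
      by (rule finitely_supported_eigenfunction)
    then show "\<exists>g v k. eigenfunction g \<and> finite {x. g x \<noteq> 0} \<and> v \<in> verts G \<and> g (v, k) \<noteq> 0" by blast
  next
    assume "\<exists>g v k. eigenfunction g \<and> finite {x. g x \<noteq> 0} \<and> v \<in> verts G \<and> g (v, k) \<noteq> 0"
    then show cover_eigenvalue by (elim exE conjE) (rule eigenfunction_imp_cover_eigenvalue)
  qed
  then show ?thesis
    by (simp only: finite_eigenfunction_iff_det det_twisted_eq_0_iff all_oriented_iff_all_degree_2)
qed

end
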